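(* Let $k$ be an even non-negative integer, let $\chi$ be an odd primitive Dirichlet character modulo $q$, and let $a,x>0$. Then for every complex $\nu$ with $\Re(\nu)>0$, \begin{align*} \sum_{n=1}^\infty\sigma_{k,\chi}(n)n^{\frac{\nu}{2}}K_\nu(a\sqrt{nx})=& \ \delta_{k} \frac{2^{\nu+1}}{a^{\nu+2}} \Gamma(1+\nu)L(1,\chi)x^{-\frac{\nu}{2}-1}+\frac{(-1)^{\frac{k}{2}}i q^k }{a^\nu 2^{k+2-\nu} \pi^{k+1}} \Gamma(\nu)\tau(\chi) \Gamma(k+1)L(k+1,\bar{\chi})\, x^{-\frac{\nu}{2}}\\ &-\frac{(-1)^{\frac{k}{2}}i a^{\nu}q^{\nu+k} x^{\frac{\nu}{2}} }{2^{3\nu+k+2} \pi^{2\nu+k+1}}\Gamma(\nu+k+1)\tau(\chi) \sum_{n=1}^\infty \frac{ \bar{\sigma}_{k,\bar{\chi}}(n)}{\left( n+\frac{a^2qx}{16\pi^2} \right)^{\nu+k+1} }, \end{align*} where $\delta_k=1$ if $k=0$ and $\delta_k=0$ if $k>0$.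
   Context: For a Dirichlet character $\chi$ and $z\in\mathbb{C}$: $\sigma_{z,\chi}(n)=\sum_{d\mid n}d^z\chi(d)$ and $\bar{\sigma}_{z,\chi}(n)=\sum_{d\mid n}d^z\chi(n/d)$. $\tau(\chi)=\sum_{h=1}^q\chi(h)e^{2\pi i h/q}$ is the Gauss sum, $L(s,\chi)$ the Dirichlet $L$-function, $\bar\chi$ the complex conjugate character, and $K_\nu$ the modified Bessel function of the second kind of order $\nu$. *)

theory Defs
  imports "HOL-Analysis.Analysis"
begin

text \<open>Dirichlet characters modulo q, viewed as functions on the naturals
(they are q-periodic, so this loses nothing).\<close>
definition dirichlet_character :: "nat \<Rightarrow> (nat \<Rightarrow> complex) \<Rightarrow> bool" where
  "dirichlet_character q chi \<longleftrightarrow> q > 0 \<and>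
     (\<forall>m n. chi (m * n) = chi m * chi n) \<and>
     (\<forall>n. chi (n + q) = chi n) \<and>
     (\<forall>n. chi n = 0 \<longleftrightarrow> \<not> coprime n q)"

definition induced_modulus :: "nat \<Rightarrow> (nat \<Rightarrow> complex) \<Rightarrow> nat \<Rightarrow> bool" where
  "induced_modulus q chi d \<longleftrightarrow> d dvd q \<and>
     (\<forall>n. coprime n q \<and> n mod d = 1 mod d \<longrightarrow> chi n = 1)"

definition primitive_character :: "nat \<Rightarrow> (nat \<Rightarrow> complex) \<Rightarrow> bool" where
  "primitive_character q chi \<longleftrightarrow> dirichlet_character q chi \<and>
     (\<forall>d. induced_modulus q chi d \<longrightarrow> d = q)"

text \<open>Odd character: chi(-1) = -1, i.e. chi(q-1) = -1.\<close>
definition odd_character :: "nat \<Rightarrow> (nat \<Rightarrow> complex) \<Rightarrow> bool" where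
  "odd_character q chi \<longleftrightarrow> chi (q - 1) = -1"

definition gauss_sum :: "nat \<Rightarrow> (nat \<Rightarrow> complex) \<Rightarrow> complex" where
  "gauss_sum q chi = (\<Sum>h=1..q. chi h * exp (2 * of_real pi * \<i> * of_nat h / of_nat q))"

text \<open>Dirichlet L-function as the (possibly conditionally convergent) Dirichlet series.\<close>
definition dirichlet_L :: "(nat \<Rightarrow> complex) \<Rightarrow> complex \<Rightarrow> complex" where
  "dirichlet_L chi s = lim (\<lambda>N. \<Sum>n=1..N. chi n / of_nat n powr s)"

definition sigma_chi :: "nat \<Rightarrow> (nat \<Rightarrow> complex) \<Rightarrow> nat \<Rightarrow> complex" where
  "sigma_chi k chi n = (\<Sum>d | d dvd n. of_nat d ^ k * chi d)"

definition sigma_bar_chi :: "nat \<Rightarrow> (nat \<Rightarrow> complex) \<Rightarrow> nat \<Rightarrow> complex" where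
  "sigma_bar_chi k chi n = (\<Sum>d | d dvd n. of_nat d ^ k * chi (n div d))"

text \<open>Modified Bessel function of the second kind, via the integral representation
K_nu(z) = int_0^infty exp(-z cosh t) cosh(nu t) dt (valid for z > 0, all complex nu).\<close>
definition besselK :: "complex \<Rightarrow> real \<Rightarrow> complex" where
  "besselK \<nu> z = integral {0..} (\<lambda>t::real. of_real (exp (- z * cosh t)) * cosh (\<nu> * of_real t))"

end

theory Submission
  imports Defs "HOL-Number_Theory.Number_Theory"
begin

text \<open>Since \<open>K_\<nu>(z)\<close> is \<open>(z/2)^(-\<nu>)/2\<close> times the integral of \<open>t^(\<nu>-1) * exp (-t - z^2/(4*t))\<close>
  over \<open>t > 0\<close>, the factor \<open>n^(\<nu>/2)\<close> cancels and the left-hand side becomes an integral of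
  the Eisenstein series \<open>F(y) = \<Sum>n. sigma_chi k chi n * exp (-n*y)\<close> evaluated at \<open>y = a^2*x/(4*t)\<close>.
  The series \<open>F\<close> has weight \<open>k + 1\<close>: it is a constant, plus a multiple of \<open>1/y\<close> if \<open>k = 0\<close>, plus
  \<open>y^(-k-1)\<close> times the dual series \<open>\<Sum>n. sigma_bar_chi k (cnj chi) n * exp (-4*pi^2*n/(q*y))\<close>.
  Integrating this identity term by term leaves Gamma integrals only.

  The transformation of \<open>F\<close> comes from expanding the character in additive characters (by
  primitivity) and applying the Lipschitz formula, i.e. the reflection formula of the polygamma
  functions, once in each of the two variables of the lattice sum of
  \<open>cnj (chi l) / (m*y + 2*pi*i*l/q)^(k+1)\<close>, with an interchange of the two summations in between.\<close>

section \<open>Primitive characters and Gauss sums\<close>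

text \<open>Parity shapes the lattice sum: for odd \<open>chi\<close> and even \<open>k\<close> the
  terms at (l, m) and (-l, -m) agree, so l can be kept positive and the poles come in pairs c + i*u,
  c - i*u. Two polygamma values then always combine into a reflection formula. The obstacle is
  \<open>k = 0\<close>. There the lattice sum converges only conditionally, and changing the order
  of summation costs a multiple of 1/y whose coefficient first appears as a finite sum of h *
  chi(h). It is carried along as an unknown and identified with L(1, chi) only at the end. The
  L-series itself is then only conditionally convergent too; its convergence is deduced over whole
  periods of length \<open>q\<close> from that of the other series. The lattice sum carries the
  conjugate character because passing through the Gauss sum conjugates once more. With b = a^2*x/4
  and y = b/t, the dual argument 4*pi^2/(q*y) equals t/c for c = a^2*q*x/(16*pi^2), which is the
  shift in the final series. \<open>Re \<nu> > 0\<close> makes t^(\<nu> - 1) integrable at 0 and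
  places the exponent of that series in its region of absolute convergence.\<close>

definition unity_exp :: "nat \<Rightarrow> nat \<Rightarrow> complex" where
  "unity_exp q n = exp (2 * of_real pi * \<i> * of_nat n / of_nat q)"

lemma unity_exp_add: "unity_exp q (m + n) = unity_exp q m * unity_exp q n"
  by (simp add: unity_exp_def exp_add [symmetric] ring_distribs add_divide_distrib)

lemma unity_exp_0 [simp]: "unity_exp q 0 = 1"
  by (simp add: unity_exp_def)

lemma unity_exp_mult: "unity_exp q (m * n) = unity_exp q m ^ n"
  by (induction n) (simp_all add: unity_exp_add)

lemma unity_exp_self: "q > 0 \<Longrightarrow> unity_exp q q = 1"
  by (simp add: unity_exp_def exp_eq_1)

lemma unity_exp_mod: "q > 0 \<Longrightarrow> unity_exp q (n mod q) = unity_exp q n"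
  by (metis mult_div_mod_eq unity_exp_add unity_exp_mult unity_exp_self power_one mult_1)

lemma unity_exp_cong: "q > 0 \<Longrightarrow> [m = n] (mod q) \<Longrightarrow> unity_exp q m = unity_exp q n"
  by (metis unity_exp_mod cong_def)

lemma unity_exp_eq_1_iff:
  assumes "q > 0" shows "unity_exp q n = 1 \<longleftrightarrow> q dvd n"
proof
  assume "unity_exp q n = 1"
  then obtain m :: int where "2 * pi * real n / real q = of_int (2 * m) * pi"
    by (auto simp: unity_exp_def exp_eq_1)
  hence "real n = of_int m * real q" using assms by (simp add: field_simps)
  hence "int n = m * int q"
    by (metis of_int_eq_iff of_int_mult of_int_of_nat_eq)
  thus "q dvd n" by (metis dvd_triv_right int_dvd_int_iff)
next
  assume "q dvd n"
  thus "unity_exp q n = 1"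
    using assms by (metis dvd_def power_one unity_exp_mult unity_exp_self)
qed

text \<open>Orthogonality of the additive characters: unless the ratio \<open>unity_exp q n\<close>
  is 1, it is another \<open>q\<close>-th root of unity and the geometric sum vanishes.\<close>

lemma sum_unity_exp:
  assumes "q > 0"
  shows "(\<Sum>h<q. unity_exp q (n * h)) = (if q dvd n then of_nat q else 0)"
proof -
  have "(\<Sum>h<q. unity_exp q (n * h)) = (\<Sum>h<q. unity_exp q n ^ h)"
    by (simp add: unity_exp_mult)
  also have "\<dots> = (if q dvd n then of_nat q else 0)"
  proof (cases "q dvd n")
    case True
    hence "unity_exp q n = 1" using assms by (simp add: unity_exp_eq_1_iff)
    thus ?thesis using True by simp
  next
    case False
    hence "unity_exp q n \<noteq> 1" using assms by (simp add: unity_exp_eq_1_iff)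
    moreover have "unity_exp q n ^ q = 1"
      using assms by (simp add: unity_exp_mult [symmetric] unity_exp_eq_1_iff)
    ultimately show ?thesis using False by (simp add: geometric_sum)
  qed
  finally show ?thesis .
qed

section \<open>Odd primitive characters and separability of their Gauss sums\<close>

locale odd_primitive_character =
  fixes q :: nat and chi :: "nat \<Rightarrow> complex"
  assumes primitive: "primitive_character q chi" and odd: "odd_character q chi"
begin

lemma character: "dirichlet_character q chi"
  using primitive by (simp add: primitive_character_def)

lemma mult: "chi (m * n) = chi m * chi n"
  using character by (simp add: dirichlet_character_def)

lemma eq_0_iff: "chi n = 0 \<longleftrightarrow> \<not> coprime n q"
  using character by (simp add: dirichlet_character_def)

text \<open>For \<open>q = 1\<close> oddness would read \<open>chi 0 = -1\<close>, while
  multiplicativity makes \<open>chi 0\<close> idempotent.\<close>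

lemma modulus_gt_1: "q > 1"
proof (rule ccontr)
  assume "\<not> q > 1"
  with character have "q = 1" by (auto simp: dirichlet_character_def)
  with odd have "chi 0 = -1" by (simp add: odd_character_def)
  with mult [of 0 0] show False by simp
qed

lemma chi_0 [simp]: "chi 0 = 0"
  using modulus_gt_1 by (simp add: eq_0_iff)

lemma chi_1 [simp]: "chi (Suc 0) = 1"
  using mult [of 1 1] eq_0_iff [of 1] by auto

lemma chi_add_mult: "chi (n + j * q) = chi n"
proof (induction j)
  case (Suc j)
  have "chi (n + Suc j * q) = chi ((n + j * q) + q)" by (simp add: algebra_simps)
  also have "\<dots> = chi n" using Suc character by (simp add: dirichlet_character_def)
  finally show ?case .
qed simp

lemma chi_mod: "chi (n mod q) = chi n"
  using chi_add_mult [of "n mod q" "n div q"] by (simp add: mult.commute)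

lemma chi_cong: "[m = n] (mod q) \<Longrightarrow> chi m = chi n"
  by (metis chi_mod cong_def)

lemma chi_power: "chi (m ^ n) = chi m ^ n"
  by (induction n) (simp_all add: mult)

text \<open>By Euler's theorem \<open>n ^ totient q\<close> is 1 modulo \<open>q\<close>, so
  \<open>chi n\<close> is a root of unity.\<close>

lemma norm_chi: "coprime n q \<Longrightarrow> norm (chi n) = 1"
proof -
  assume "coprime n q"
  hence "[n ^ totient q = 1] (mod q)" by (rule euler_theorem)
  hence "chi n ^ totient q = 1" using chi_cong chi_power by fastforce
  moreover have "totient q > 0" using modulus_gt_1 by simp
  ultimately show ?thesis
    by (metis norm_ge_zero norm_one norm_power power_eq_1_iff neq0_conv)
qed

lemma norm_chi_le: "norm (chi n) \<le> 1"
  using norm_chi [of n] eq_0_iff [of n] by (cases "coprime n q") auto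

lemma chi_mult_cnj: "coprime n q \<Longrightarrow> chi n * cnj (chi n) = 1"
  by (simp add: complex_norm_square [symmetric] norm_chi)

lemma chi_minus:
  assumes "h \<le> q" shows "chi (q - h) = - chi h"
proof (cases "h = 0")
  case True
  thus ?thesis using eq_0_iff [of q] modulus_gt_1 by simp
next
  case False
  \<comment> \<open>Both q - h and (q - 1) * h represent -h. As an exact identity of naturals this
    needs \<open>h > 0\<close>, because of the truncated \<open>h - 1\<close>.\<close>
  have "(q - 1) * h = (q - h) + (h - 1) * q"
  proof -
    obtain h' where h': "h = Suc h'" using False by (cases h) auto
    obtain r where r: "q = h + r" using assms le_Suc_ex by blast
    show ?thesis using h' r by (simp add: algebra_simps)
  qed
  hence "chi (q - 1) * chi h = chi (q - h)" by (metis mult chi_add_mult)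
  with odd show ?thesis by (simp add: odd_character_def)
qed

text \<open>Oddness pairs h with q - h. This cancellation later removes every divergent or constant
  contribution in weight one.\<close>

lemma sum_chi: "(\<Sum>h=1..<q. chi h) = 0"
proof -
  have "(\<Sum>h=1..<q. chi h) = (\<Sum>h=1..<q. chi (q - h))"
    by (rule sum.reindex_bij_witness [of _ "\<lambda>h. q - h" "\<lambda>h. q - h"]) auto
  also have "\<dots> = - (\<Sum>h=1..<q. chi h)"
    by (simp add: chi_minus sum_negf)
  finally show ?thesis by simp
qed

lemma sum_lessThan_conv: 
  fixes f :: "nat \<Rightarrow> complex"
  assumes "f 0 = 0" shows "(\<Sum>h<q. f h) = (\<Sum>h=1..<q. f h)"
proof -
  have "{..<q} = insert 0 {1..<q}" using modulus_gt_1 by auto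
  thus ?thesis using assms by simp
qed

lemma gauss_sum_eq: "gauss_sum q chi = (\<Sum>h<q. chi h * unity_exp q h)"
proof -
  have "{1..q} = insert q {1..<q}" using modulus_gt_1 by auto
  moreover have "chi q = 0" using chi_minus [of 0] by simp
  ultimately show ?thesis
    by (simp add: gauss_sum_def unity_exp_def sum_lessThan_conv)
qed

text \<open>Multiplication by a unit permutes the residues modulo \<open>q\<close>.\<close>

lemma sum_mult_reindex:
  fixes f :: "nat \<Rightarrow> complex"
  assumes "coprime a q" and "\<And>h. f (h mod q) = f h"
  shows "(\<Sum>h<q. f (h * a)) = (\<Sum>h<q. f h)"
proof -
  have inj: "inj_on (\<lambda>h. h * a mod q) {..<q}"
  proof (rule inj_onI)
    fix h h' assume "h \<in> {..<q}" "h' \<in> {..<q}" "h * a mod q = h' * a mod q"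
    hence "[h = h'] (mod q)"
      using assms(1) cong_mult_rcancel_nat [of a q h h'] by (simp add: cong_def coprime_commute)
    thus "h = h'" using \<open>h \<in> {..<q}\<close> \<open>h' \<in> {..<q}\<close> by (simp add: cong_def)
  qed
  have "(\<lambda>h. h * a mod q) ` {..<q} = {..<q}"
    using modulus_gt_1 by (intro endo_inj_surj inj) auto
  hence "(\<Sum>h<q. f h) = (\<Sum>h<q. f (h * a mod q))"
    using sum.reindex [OF inj, of f] by simp
  thus ?thesis using assms(2) by simp
qed

text \<open>For \<open>d\<close> coprime to \<open>q\<close>, replace h by h*d. Otherwise q / gcd d
  q is a proper divisor of \<open>q\<close>, hence by primitivity not an induced modulus, which
  provides a unit n congruent to 1 modulo it with \<open>chi n \<noteq> 1\<close>. Since n*d is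
  congruent to d modulo \<open>q\<close>, replacing h by h*n multiplies the sum by
  \<open>chi n\<close> without changing it, so it is 0.\<close>

lemma gauss_separable:
  "(\<Sum>h<q. chi h * unity_exp q (h * d)) = cnj (chi d) * gauss_sum q chi"
proof (cases "coprime d q")
  case True
  have "(\<Sum>h<q. chi h * unity_exp q h) = (\<Sum>h<q. chi (h * d) * unity_exp q (h * d))"
    using modulus_gt_1 by (subst sum_mult_reindex [OF True, symmetric])
      (simp_all add: chi_mod unity_exp_mod)
  also have "\<dots> = chi d * (\<Sum>h<q. chi h * unity_exp q (h * d))"
    by (simp add: mult sum_distrib_left mult_ac)
  finally have "gauss_sum q chi = chi d * (\<Sum>h<q. chi h * unity_exp q (h * d))"
    by (simp add: gauss_sum_eq)
  hence "cnj (chi d) * gauss_sum q chi = (chi d * cnj (chi d)) * (\<Sum>h<q. chi h * unity_exp q (h * d))"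
    by (simp add: mult_ac)
  thus ?thesis using True by (simp add: chi_mult_cnj)
next
  case False
  define g where "g = gcd d q"
  define q' where "q' = q div g"
  have g: "g > 1" "g dvd q" "g dvd d"
    using False modulus_gt_1 unfolding g_def
    by (metis coprime_iff_gcd_eq_1 gcd_pos_nat less_one nat_neq_iff not_less_zero, auto)
  have q': "q = q' * g" using g by (simp add: q'_def)
  hence "q' \<noteq> q" using g modulus_gt_1 by (cases "q' = 0") auto
  hence "\<not> induced_modulus q chi q'" 
    using primitive by (auto simp: primitive_character_def)
  then obtain n where n: "coprime n q" "[n = 1] (mod q')" "chi n \<noteq> 1"
    using q' by (auto simp: induced_modulus_def cong_def)
  have "[n * d = d] (mod q)"
  proof -
    have "[n * d = 1 * d] (mod q' * d)" using n(2)
      by (metis cong_def mod_mult_mult2)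
    moreover have "q dvd q' * d" using q' g(3) by (simp add: mult_dvd_mono)
    ultimately show ?thesis by (auto dest: cong_dvd_modulus_nat)
  qed
  hence *: "unity_exp q (h * n * d) = unity_exp q (h * d)" for h
    using modulus_gt_1 
    by (intro unity_exp_cong) (auto simp: mult.assoc intro: cong_scalar_left)
  have "(\<Sum>h<q. chi h * unity_exp q (h * d)) = (\<Sum>h<q. chi (h * n) * unity_exp q (h * n * d))"
    using modulus_gt_1
    by (subst sum_mult_reindex [OF n(1), symmetric])
      (auto simp: chi_mod intro!: arg_cong2 [of _ _ _ _ "(*)"] unity_exp_cong, 
       simp add: cong_def mod_mult_left_eq)
  also have "\<dots> = chi n * (\<Sum>h<q. chi h * unity_exp q (h * d))"
    by (simp only: * mult) (simp add: sum_distrib_left mult_ac)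
  finally have "(\<Sum>h<q. chi h * unity_exp q (h * d)) = 0" using n(3) by simp
  thus ?thesis using False eq_0_iff by simp
qed

text \<open>Makes every result of the locale available for the conjugate character.\<close>

lemma odd_primitive_character_cnj: "odd_primitive_character q (\<lambda>n. cnj (chi n))"
proof
  have "induced_modulus q (\<lambda>n. cnj (chi n)) d \<longleftrightarrow> induced_modulus q chi d" for d
    by (simp add: induced_modulus_def)
  thus "primitive_character q (\<lambda>n. cnj (chi n))"
    using primitive by (simp add: primitive_character_def dirichlet_character_def)
  show "odd_character q (\<lambda>n. cnj (chi n))"
    using odd by (simp add: odd_character_def)
qed

text \<open>Separability turns the product into a double sum of additive characters, in which
  orthogonality leaves only h = q - 1; the sign is \<open>chi (q - 1)\<close>.\<close>

lemma gauss_sum_mult_cnj: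
  "gauss_sum q chi * gauss_sum q (\<lambda>n. cnj (chi n)) = - of_nat q"
proof -
  interpret c: odd_primitive_character q "\<lambda>n. cnj (chi n)" by (rule odd_primitive_character_cnj)
  let ?g = "gauss_sum q chi" and ?g' = "gauss_sum q (\<lambda>n. cnj (chi n))"
  have "?g * ?g' = (\<Sum>d<q. (cnj (chi d) * ?g) * unity_exp q d)"
    by (simp add: c.gauss_sum_eq sum_distrib_left mult_ac)
  also have "\<dots> = (\<Sum>d<q. \<Sum>h<q. chi h * unity_exp q ((h + 1) * d))"
    by (simp add: gauss_separable [symmetric] sum_distrib_left sum_distrib_right unity_exp_add
        mult_ac)
  also have "\<dots> = (\<Sum>h<q. chi h * (\<Sum>d<q. unity_exp q ((h + 1) * d)))"
    by (subst sum.swap) (simp add: sum_distrib_left)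
  also have "\<dots> = (\<Sum>h<q. chi h * (if h = q - 1 then of_nat q else 0))"
  proof (intro sum.cong refl arg_cong2 [of _ _ _ _ "(*)"])
    fix h assume "h \<in> {..<q}"
    hence "q dvd h + 1 \<longleftrightarrow> h = q - 1"
      by (metis Suc_eq_plus1 Suc_pred' dvd_refl lessThan_iff modulus_gt_1 nat_dvd_not_less
          not_less_eq order_less_trans zero_less_Suc zero_less_one diff_Suc_1 linorder_neqE_nat)
    thus "(\<Sum>d<q. unity_exp q ((h + 1) * d)) = (if h = q - 1 then of_nat q else 0)"
      using modulus_gt_1 sum_unity_exp [of q "h + 1"] by simp
  qed
  also have "\<dots> = chi (q - 1) * of_nat q"
    using modulus_gt_1 by (simp add: if_distrib [of "\<lambda>x. chi _ * x"] sum.delta' cong: if_cong)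
  finally show ?thesis using odd by (simp add: odd_character_def)
qed

lemma gauss_sum_nonzero: "gauss_sum q chi \<noteq> 0"
  using gauss_sum_mult_cnj modulus_gt_1 by auto

end

section \<open>The Lipschitz summation formula\<close>

text \<open>The polylogarithm of order -k, which is the exponential side of the Lipschitz formula at
  w = exp(2*pi*i*z).\<close>

definition power_polylog :: "nat \<Rightarrow> complex \<Rightarrow> complex" where
  "power_polylog k w = (\<Sum>d. of_nat (Suc d) ^ k * w ^ Suc d)"

text \<open>Ratio test: (1 + 1/n)^k tends to 1, so the ratios eventually stay below any
  \<open>c\<close> strictly between \<open>norm w\<close> and 1. The type is general because both
  real and complex instances are used.\<close>

lemma summable_power_polylog:
  fixes w :: "'a :: {banach, real_normed_field}"
  assumes "norm w < 1"
  shows "summable (\<lambda>d. norm (of_nat (Suc d) ^ k * w ^ Suc d))"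
proof (cases "w = 0")
  case False
  obtain c where c: "norm w < c" "c < 1" using assms dense by blast
  have "(\<lambda>n. (1 + 1 / real (Suc n)) ^ k * norm w) \<longlonglongrightarrow> (1 + 0) ^ k * norm w"
    by (intro tendsto_intros LIMSEQ_Suc [OF lim_1_over_n])
  hence "\<forall>\<^sub>F n in sequentially. (1 + 1 / real (Suc n)) ^ k * norm w < c"
    using c(1) by (intro order_tendstoD) simp_all
  then obtain M where M: "\<And>n. n \<ge> M \<Longrightarrow> (1 + 1 / real (Suc n)) ^ k * norm w < c"
    by (auto simp: eventually_sequentially)
  show ?thesis
  proof (rule summable_ratio_test [OF c(2)])
    fix n assume "n \<ge> M"
    have eq: "real (Suc (Suc n)) = (1 + 1 / real (Suc n)) * real (Suc n)" by (simp add: field_simps)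
    have pos: "\<bar>1 + 1 / real (Suc n)\<bar> = 1 + 1 / real (Suc n)" by simp
    have "norm (norm (of_nat (Suc (Suc n)) ^ k * w ^ Suc (Suc n))) =
        ((1 + 1 / real (Suc n)) ^ k * norm w) * (real (Suc n) ^ k * norm w ^ Suc n)"
      by (simp only: norm_mult norm_power norm_of_nat eq pos power_mult_distrib abs_norm_cancel
          power_Suc mult_ac real_norm_def abs_mult power_abs abs_of_nat)
    also have "\<dots> \<le> c * (real (Suc n) ^ k * norm w ^ Suc n)"
      using M [OF \<open>n \<ge> M\<close>] by (intro mult_right_mono) auto
    finally show "norm (norm (of_nat (Suc (Suc n)) ^ k * w ^ Suc (Suc n)))
        \<le> c * norm (norm (of_nat (Suc n) ^ k * w ^ Suc n))"
      by (simp only: norm_mult norm_power norm_of_nat real_norm_def abs_mult power_abs abs_of_nat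
          abs_norm_cancel)
  qed
qed simp

lemma power_polylog_sums:
  assumes "norm w < 1"
  shows "(\<lambda>d. of_nat (Suc d) ^ k * w ^ Suc d) sums power_polylog k w"
  unfolding power_polylog_def
  using summable_norm_cancel [OF summable_power_polylog [OF assms]] by (rule summable_sums)

lemma power_polylog_0:
  assumes "norm w < 1" shows "power_polylog 0 w = w / (1 - w)"
proof -
  have "(\<lambda>d. w * w ^ d) sums (w * (1 / (1 - w)))"
    by (intro sums_mult geometric_sums assms)
  moreover have "(\<lambda>d. w * w ^ d) sums power_polylog 0 w"
    using power_polylog_sums [OF assms, of 0] by simp
  ultimately show ?thesis using sums_unique2 by fastforce
qed

text \<open>Differentiation in z multiplies the d-th term by 2*pi*i*d and so raises \<open>k\<close>
  by one; this drives the induction for the polygamma reflection.\<close>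

lemma has_field_derivative_power_polylog_exp:
  assumes "Im z > 0"
  shows "((\<lambda>z. power_polylog k (exp (2 * of_real pi * \<i> * z))) has_field_derivative
          2 * of_real pi * \<i> * power_polylog (Suc k) (exp (2 * of_real pi * \<i> * z))) (at z)"
proof -
  define w where "w = exp (2 * of_real pi * \<i> * z)"
  have w: "norm w < 1" using assms by (simp add: w_def)
  \<comment> \<open>The coefficient at 0 is set to 0 by hand: the polylogarithm starts at
    \<open>w\<close>, but \<open>0 ^ 0 = 1\<close> when \<open>k = 0\<close>.\<close>
  define c where "c n = (if n = 0 then 0 else of_nat n ^ k :: complex)" for n
  have eq: "power_polylog k v = (\<Sum>n. c n * v ^ n)" if "norm v < 1" for v
  proof -
    have "(\<lambda>d. c (Suc d) * v ^ Suc d) sums power_polylog k v"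
      using power_polylog_sums [OF that, of k] by (simp add: c_def)
    from sums_Suc [OF this] show ?thesis by (simp add: c_def sums_iff)
  qed
  have summ: "summable (\<lambda>n. c n * v ^ n)" if "norm v < 1" for v
    using summable_norm_cancel [OF summable_power_polylog [OF that, of k]]
    by (subst summable_Suc_iff [symmetric]) (simp add: c_def)
  obtain r where r: "norm w < r" "r < 1" using w dense by blast
  have r0: "r > 0" using r(1) norm_ge_zero [of w] by linarith
  have d: "((\<lambda>v. \<Sum>n. c n * v ^ n) has_field_derivative (\<Sum>n. diffs c n * w ^ n)) (at w)"
    by (rule termdiffs_strong [where K = "of_real r"]) (use r r0 in \<open>auto intro!: summ\<close>)
  have "((\<lambda>v. power_polylog k v) has_field_derivative (\<Sum>n. diffs c n * w ^ n)) (at w)"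
  proof (rule DERIV_cong_ev [THEN iffD2, OF refl _ refl d])
    show "\<forall>\<^sub>F v in nhds w. power_polylog k v = (\<Sum>n. c n * v ^ n)"
      using eventually_nhds_in_open [of "ball 0 1" w] w
      by (auto elim!: eventually_mono simp: eq)
  qed
  moreover have "((\<lambda>z. exp (2 * of_real pi * \<i> * z)) has_field_derivative 
      w * (2 * of_real pi * \<i>)) (at z)"
    unfolding w_def by (auto intro!: derivative_eq_intros)
  ultimately have "((\<lambda>z. power_polylog k (exp (2 * of_real pi * \<i> * z))) has_field_derivative
      (\<Sum>n. diffs c n * w ^ n) * (w * (2 * of_real pi * \<i>))) (at z)"
    unfolding w_def by (rule DERIV_chain2)
  moreover have "(\<Sum>n. diffs c n * w ^ n) * w = power_polylog (Suc k) w"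
  proof -
    have "summable (\<lambda>n. diffs c n * w ^ n)"
      by (rule termdiff_converges [where K = 1]) (use w in \<open>auto intro!: summ\<close>)
    hence "(\<Sum>n. diffs c n * w ^ n) * w = (\<Sum>n. diffs c n * w ^ n * w)"
      by (rule suminf_mult2)
    also have "\<dots> = power_polylog (Suc k) w"
      unfolding power_polylog_def by (intro suminf_cong) (simp add: c_def diffs_def mult_ac)
    finally show ?thesis .
  qed
  ultimately show ?thesis by (simp add: w_def mult_ac)
qed

section \<open>Reflection formulas for the polygamma functions\<close>

lemma not_nonpos_Ints_of_Im: "Im z \<noteq> 0 \<Longrightarrow> (z :: complex) \<notin> \<int>\<^sub>\<le>\<^sub>0"
  by (auto elim!: nonpos_Ints_cases)

text \<open>Logarithmic derivative of Gamma(z) * Gamma(1 - z) = pi / sin(pi*z).\<close>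

lemma Digamma_reflection:
  assumes "Im z > 0"
  shows "Digamma (1 - z) - Digamma z = of_real pi * cot (of_real pi * z)"
proof -
  have nz: "z \<notin> \<int>\<^sub>\<le>\<^sub>0" "1 - z \<notin> \<int>\<^sub>\<le>\<^sub>0" using assms by (auto intro!: not_nonpos_Ints_of_Im)
  have sin: "sin (of_real pi * z) \<noteq> 0"
  proof
    assume "sin (of_real pi * z) = 0"
    then obtain n :: int where "of_real pi * z = of_real (of_int n * pi)" by (auto simp: sin_eq_0)
    from arg_cong [OF this, of Im] show False using assms by simp
  qed
  have G: "Gamma z \<noteq> 0" "Gamma (1 - z) \<noteq> 0" using nz by (auto simp: Gamma_eq_zero_iff)
  have d1: "((\<lambda>z. Gamma z * Gamma (1 - z)) has_field_derivative
      Gamma z * Gamma (1 - z) * (Digamma z - Digamma (1 - z))) (at z)"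
    using nz by (auto intro!: derivative_eq_intros simp: algebra_simps)
  have d2: "((\<lambda>z. of_real pi / sin (of_real pi * z)) has_field_derivative
      - (of_real pi / sin (of_real pi * z)) * (of_real pi * cot (of_real pi * z))) (at z)"
    using sin by (auto intro!: derivative_eq_intros simp: cot_def field_simps power2_eq_square)
  have "Gamma z * Gamma (1 - z) * (Digamma z - Digamma (1 - z)) =
      - (of_real pi / sin (of_real pi * z)) * (of_real pi * cot (of_real pi * z))"
    using d2 unfolding Gamma_reflection_complex [symmetric] by (rule DERIV_unique [OF d1])
  hence "Gamma z * Gamma (1 - z) * (Digamma z - Digamma (1 - z)) =
      Gamma z * Gamma (1 - z) * (- (of_real pi * cot (of_real pi * z)))"
    by (simp add: Gamma_reflection_complex)
  hence "Digamma z - Digamma (1 - z) = - (of_real pi * cot (of_real pi * z))"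
    using G by (subst (asm) mult_cancel_left) auto
  thus ?thesis by (simp add: algebra_simps)
qed

text \<open>In terms of w = exp(2*pi*i*z) the cotangent is i*(w + 1)/(w - 1), and
  \<open>norm w < 1\<close> in the upper half plane gives a geometric series.\<close>

lemma cot_eq_power_polylog:
  assumes "Im z > 0"
  shows "of_real pi * cot (of_real pi * z) =
    - of_real pi * \<i> - 2 * of_real pi * \<i> * power_polylog 0 (exp (2 * of_real pi * \<i> * z))"
proof -
  define u where "u = exp (\<i> * (of_real pi * z))"
  define w where "w = exp (2 * of_real pi * \<i> * z)"
  have w: "norm w < 1" using assms by (simp add: w_def)
  hence w1: "w \<noteq> 1" by auto
  have u: "u \<noteq> 0" "w = u * u" by (simp_all add: u_def w_def exp_add [symmetric] algebra_simps)
  have inv: "exp (- (\<i> * (of_real pi * z))) = 1 / u" by (simp add: u_def exp_minus field_simps)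
  have "cot (of_real pi * z) = \<i> * (u * u + 1) / (u * u - 1)"
    using u w1 unfolding cot_def cos_exp_eq sin_exp_eq inv u_def [symmetric]
    by (simp add: field_simps)
  also have "\<dots> = \<i> * (w + 1) / (w - 1)" by (simp add: u)
  also have "\<dots> = - \<i> - 2 * \<i> * (w / (1 - w))" using w1 by (simp add: divide_simps) (simp add: algebra_simps)
  finally have "cot (of_real pi * z) = - \<i> - 2 * \<i> * power_polylog 0 w"
    using w by (simp add: power_polylog_0)
  thus ?thesis unfolding w_def [symmetric] by (simp only: right_diff_distrib) simp
qed

text \<open>Induction by differentiation: the identity holds on the whole open half plane, so both
  sides may be differentiated. The constant of the cotangent survives only at
  \<open>k = 0\<close>.\<close>

lemma Polygamma_reflection:
  assumes "Im z > 0"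
  shows "(-1) ^ k * Polygamma k (1 - z) - Polygamma k z =
    (if k = 0 then - of_real pi * \<i> else 0)
    - (2 * of_real pi * \<i>) ^ Suc k * power_polylog k (exp (2 * of_real pi * \<i> * z))"
  using assms
proof (induction k arbitrary: z)
  case 0
  thus ?case using Digamma_reflection [of z] cot_eq_power_polylog [of z] by simp
next
  case (Suc k)
  have nz: "z \<notin> \<int>\<^sub>\<le>\<^sub>0" "1 - z \<notin> \<int>\<^sub>\<le>\<^sub>0" using Suc.prems by (auto intro!: not_nonpos_Ints_of_Im)
  have d1: "((\<lambda>z. (-1) ^ k * Polygamma k (1 - z) - Polygamma k z) has_field_derivative
      (-1) ^ Suc k * Polygamma (Suc k) (1 - z) - Polygamma (Suc k) z) (at z)"
    using nz by (auto intro!: derivative_eq_intros)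
  have d2: "((\<lambda>z. (if k = 0 then - of_real pi * \<i> else 0)
      - (2 * of_real pi * \<i>) ^ Suc k * power_polylog k (exp (2 * of_real pi * \<i> * z))) 
      has_field_derivative (0 - (2 * of_real pi * \<i>) ^ Suc k *
      (2 * of_real pi * \<i> * power_polylog (Suc k) (exp (2 * of_real pi * \<i> * z))))) (at z)"
    by (intro DERIV_diff DERIV_const DERIV_cmult has_field_derivative_power_polylog_exp Suc.prems)
  have ev: "\<forall>\<^sub>F z in nhds z. (-1) ^ k * Polygamma k (1 - z) - Polygamma k z =
      (if k = 0 then - of_real pi * \<i> else 0)
      - (2 * of_real pi * \<i>) ^ Suc k * power_polylog k (exp (2 * of_real pi * \<i> * z))"
    using eventually_nhds_in_open [of "{z. Im z > 0}" z] Suc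
    by (auto elim!: eventually_mono simp: open_halfspace_Im_gt)
  have "((\<lambda>z. (-1) ^ k * Polygamma k (1 - z) - Polygamma k z) has_field_derivative
      (0 - (2 * of_real pi * \<i>) ^ Suc k *
      (2 * of_real pi * \<i> * power_polylog (Suc k) (exp (2 * of_real pi * \<i> * z))))) (at z)"
    by (subst DERIV_cong_ev [OF refl ev refl]) (rule d2)
  from DERIV_unique [OF d1 this]
  show ?case by (simp only: power_Suc mult_ac) simp
qed

text \<open>At \<open>k = 0\<close> each single series of 1/(s + j) diverges; in the limit defining
  \<open>Digamma\<close> the logarithms cancel because the coefficients sum to 0.\<close>

lemma Polygamma_combination_sums:
  fixes c s :: "'a \<Rightarrow> complex"
  assumes "finite I" and "(\<Sum>i\<in>I. c i) = 0" and "\<And>i. i \<in> I \<Longrightarrow> s i \<noteq> 0"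
  shows "(\<lambda>j. \<Sum>i\<in>I. c i / (s i + of_nat j) ^ Suc k) sums
    ((-1) ^ Suc k / fact k * (\<Sum>i\<in>I. c i * Polygamma k (s i)))"
proof (cases "k = 0")
  case True
  have "(\<lambda>m. \<Sum>i\<in>I. c i * (of_real (ln (real m)) - (\<Sum>n<m. inverse (s i + of_nat n))))
      \<longlonglongrightarrow> (\<Sum>i\<in>I. c i * Digamma (s i))"
    by (intro tendsto_intros Digamma_LIMSEQ assms)
  hence "(\<lambda>m. - (\<Sum>i\<in>I. c i * (of_real (ln (real m)) - (\<Sum>n<m. inverse (s i + of_nat n)))))
      \<longlonglongrightarrow> - (\<Sum>i\<in>I. c i * Digamma (s i))"
    by (rule tendsto_minus)
  also have "(\<lambda>m. - (\<Sum>i\<in>I. c i * (of_real (ln (real m)) - (\<Sum>n<m. inverse (s i + of_nat n))))) =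
      (\<lambda>m. \<Sum>j<m. \<Sum>i\<in>I. c i / (s i + of_nat j))"
  proof
    fix m
    have "- (\<Sum>i\<in>I. c i * (of_real (ln (real m)) - (\<Sum>n<m. inverse (s i + of_nat n)))) =
       - (\<Sum>i\<in>I. c i) * of_real (ln (real m)) + (\<Sum>i\<in>I. \<Sum>n<m. c i / (s i + of_nat n))"
      by (simp add: sum_subtractf right_diff_distrib sum_distrib_left sum_distrib_right
          divide_inverse)
    also have "\<dots> = (\<Sum>j<m. \<Sum>i\<in>I. c i / (s i + of_nat j))"
      using assms(2) by (simp add: sum.swap [of _ I])
    finally show "- (\<Sum>i\<in>I. c i * (of_real (ln (real m)) - (\<Sum>n<m. inverse (s i + of_nat n)))) =
       (\<Sum>j<m. \<Sum>i\<in>I. c i / (s i + of_nat j))" .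
  qed
  finally show ?thesis using True by (simp add: sums_def)
next
  case False
  have "(\<lambda>j. \<Sum>i\<in>I. c i * inverse ((s i + of_nat j) ^ Suc k)) sums
      (\<Sum>i\<in>I. c i * ((-1) ^ Suc k * Polygamma k (s i) / fact k))"
    using assms False by (intro sums_sum sums_mult Polygamma_LIMSEQ) auto
  thus ?thesis by (simp add: sum_distrib_left divide_inverse mult_ac)
qed

text \<open>This is the Lipschitz formula for the sum over all integers n of 1/(c + i*n*v)^(k+1),
  with n and -n paired to force convergence at \<open>k = 0\<close> and the term n = 0 moved to the
  right-hand side.\<close>

lemma Lipschitz_sums:
  fixes c v :: real
  assumes "even k" "c > 0" "v > 0"
  shows "(\<lambda>m. 1 / (of_real c + \<i> * of_real (real (Suc m) * v)) ^ Suc k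
           + 1 / (of_real c - \<i> * of_real (real (Suc m) * v)) ^ Suc k) sums
    ((if k = 0 then of_real (pi / v) else 0) - 1 / of_real c ^ Suc k
     + of_real (2 * pi / v) ^ Suc k / fact k * power_polylog k (of_real (exp (- 2 * pi * c / v))))"
proof -
  \<comment> \<open>Multiplication by i/v carries c - i*n*v to z + n and places z in the upper half
    plane, where the reflection formula applies.\<close>
  define z where "z = \<i> * of_real (c / v)"
  have z: "Im z > 0" using assms by (simp add: z_def)
  hence nz: "z \<noteq> 0" "1 - z \<noteq> 0" "z \<noteq> 1" by auto
  define P where "P = power_polylog k (of_real (exp (- 2 * pi * c / v)))"
  have P: "P = power_polylog k (exp (2 * of_real pi * \<i> * z))"
    by (simp add: P_def z_def exp_of_real [symmetric] algebra_simps)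
  have "(\<lambda>j. \<Sum>i\<in>{z, 1 - z}. (if i = z then 1 else -1) / (i + of_nat j) ^ Suc k) sums
    ((-1) ^ Suc k / fact k * (\<Sum>i\<in>{z, 1 - z}. (if i = z then 1 else -1) * Polygamma k i))"
    (is "?f sums ?F")
    using z by (intro Polygamma_combination_sums) (auto simp: nz complex_eq_iff)
  moreover have "1 - z \<noteq> z" using z by (auto simp: complex_eq_iff)
  hence "?f = (\<lambda>j. 1 / (z + of_nat j) ^ Suc k - 1 / (1 - z + of_nat j) ^ Suc k)"
     and "?F = 1 / fact k * (Polygamma k (1 - z) - Polygamma k z)"
    using assms(1) by (auto simp: field_simps)
  ultimately have "(\<lambda>j. 1 / (z + of_nat j) ^ Suc k - 1 / (1 - z + of_nat j) ^ Suc k) sums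
      (1 / fact k * (Polygamma k (1 - z) - Polygamma k z))" by simp
  \<comment> \<open>The reflection formula pairs z + j with 1 - z + j, whereas the pairing needed is
    z + j + 1 with z - (j + 1). This telescoping series shifts the first family by one and
    contributes the term -1/c^(k+1).\<close>
  moreover have "(\<lambda>j. 1 / (z + of_nat (Suc j)) ^ Suc k - 1 / (z + of_nat j) ^ Suc k) sums
      (0 - 1 / (z + of_nat 0) ^ Suc k)"
  proof (rule telescope_sums)
    have "(\<lambda>n. inverse (z + of_nat n)) \<longlonglongrightarrow> 0"
      by (intro tendsto_inverse_0_at_top tendsto_inverse_0 [THEN filterlim_compose]
          tendsto_add_filterlim_at_infinity [OF tendsto_const] tendsto_of_nat)
    from tendsto_power [OF this, of "Suc k"]
    show "(\<lambda>n. 1 / (z + of_nat n) ^ Suc k) \<longlonglongrightarrow> 0" by (simp add: field_simps)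
  qed
  ultimately have "(\<lambda>j. (1 / (z + of_nat j) ^ Suc k - 1 / (1 - z + of_nat j) ^ Suc k) +
      (1 / (z + of_nat (Suc j)) ^ Suc k - 1 / (z + of_nat j) ^ Suc k)) sums
      (1 / fact k * (Polygamma k (1 - z) - Polygamma k z) + (0 - 1 / (z + of_nat 0) ^ Suc k))"
    by (rule sums_add)
  from sums_mult [OF this, of "(\<i> / of_real v) ^ Suc k"]
  have "(\<lambda>j. (\<i> / of_real v) ^ Suc k * (1 / (z + of_nat (Suc j)) ^ Suc k - 1 / (1 - z + of_nat j) ^ Suc k)) 
      sums ((\<i> / of_real v) ^ Suc k * (1 / fact k * (Polygamma k (1 - z) - Polygamma k z) - 1 / z ^ Suc k))"
    by (simp del: power_Suc of_nat_Suc)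
  moreover have "(\<i> / of_real v) ^ Suc k * (1 / (z + of_nat (Suc j)) ^ Suc k - 1 / (1 - z + of_nat j) ^ Suc k) =
      1 / (of_real c + \<i> * of_real (real (Suc j) * v)) ^ Suc k
           + 1 / (of_real c - \<i> * of_real (real (Suc j) * v)) ^ Suc k" for j
  proof -
    have e1: "z + of_nat (Suc j) = (\<i> / of_real v) * (of_real c - \<i> * of_real (real (Suc j) * v))"
      using assms by (simp add: z_def field_simps)
    have e2: "1 - z + of_nat j = - ((\<i> / of_real v) * (of_real c + \<i> * of_real (real (Suc j) * v)))"
      using assms by (simp add: z_def field_simps)
    have neg: "(- w) ^ Suc k = - (w ^ Suc k)" for w :: complex using assms(1) by simp
    have "a ^ Suc k * (1 / (a * y) ^ Suc k - 1 / (- (a * x)) ^ Suc k) = 1 / x ^ Suc k + 1 / y ^ Suc k"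
      if "a \<noteq> 0" for a x y :: complex
      using that unfolding neg power_mult_distrib
      by (simp add: distrib_left del: power_Suc)
    moreover have "\<i> / of_real v \<noteq> 0" using assms by simp
    ultimately show ?thesis unfolding e1 e2 by blast
  qed
  moreover have "(\<i> / of_real v) ^ Suc k * (1 / fact k * (Polygamma k (1 - z) - Polygamma k z) - 1 / z ^ Suc k) =
     (if k = 0 then of_real (pi / v) else 0) - 1 / of_real c ^ Suc k
     + of_real (2 * pi / v) ^ Suc k / fact k * P"
  proof -
    have alg: "X * (1 / f * (D - W * Q) - Z) = X * (1 / f * D) - (X * W) / f * Q - X * Z"
      for X f D W Q Z :: complex by (simp add: algebra_simps diff_divide_distrib)
    have 1: "Polygamma k (1 - z) - Polygamma k z = (if k = 0 then - of_real pi * \<i> else 0)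
      - (2 * of_real pi * \<i>) ^ Suc k * P"
      using Polygamma_reflection [OF z, of k] assms(1) by (simp add: P)
    have 2: "(\<i> / of_real v) ^ Suc k * (1 / z ^ Suc k) = 1 / of_real c ^ Suc k"
      using assms by (simp add: z_def power_mult_distrib power_divide del: power_Suc)
    have "(\<i> / of_real v) ^ Suc k * (2 * of_real pi * \<i>) ^ Suc k = (- of_real (2 * pi / v)) ^ Suc k"
      by (simp only: power_mult_distrib [symmetric]) (simp add: field_simps)
    hence 3: "(\<i> / of_real v) ^ Suc k * (2 * of_real pi * \<i>) ^ Suc k = - (of_real (2 * pi / v) ^ Suc k)"
      using assms(1) by simp
    have 4: "(\<i> / of_real v) ^ Suc k * (1 / fact k * (if k = 0 then - of_real pi * \<i> else 0)) =
        (if k = 0 then of_real (pi / v) else 0)" by (simp add: mult.left_commute [of \<i>])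
    show ?thesis unfolding 1 alg 2 3 4 by simp
  qed
  ultimately show ?thesis by (simp add: P_def)
qed

section \<open>Double series\<close>

lemma summable_on_product:
  fixes p r :: "nat \<Rightarrow> real"
  assumes "summable p" "summable r" "\<And>i. p i \<ge> 0" "\<And>j. r j \<ge> 0"
  shows "(\<lambda>(i,j). p i * r j) summable_on UNIV \<times> UNIV"
proof (rule summable_on_SigmaI)
  have "r summable_on UNIV" "p summable_on UNIV"
    using assms by (simp_all add: summable_on_UNIV_nonneg_real_iff)
  thus "((\<lambda>j. case (i, j) of (i, j) \<Rightarrow> p i * r j) has_sum (p i * infsum r UNIV)) UNIV" for i
    by (simp add: has_sum_cmult_right)
  show "(\<lambda>i. p i * infsum r UNIV) summable_on UNIV"
    using \<open>p summable_on UNIV\<close> by (rule summable_on_cmult_left)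
qed (use assms in auto)

text \<open>Factorisations n + 1 = (i + 1) * (j + 1), all indices shifted by one since the series
  are indexed from 0.\<close>

lemma bij_betw_dvd_Suc_Sigma:
  "bij_betw (\<lambda>(n, d). (d - 1, Suc n div d - 1)) (Sigma UNIV (\<lambda>n. {d. d dvd Suc n})) (UNIV \<times> UNIV)"
proof (rule bij_betwI [where g = "\<lambda>(i, j). (Suc i * Suc j - 1, Suc i)"])
  show "(\<lambda>(i, j). (Suc i * Suc j - 1, Suc i)) \<in> UNIV \<times> UNIV \<rightarrow> Sigma UNIV (\<lambda>n. {d. d dvd Suc n})"
    by (auto simp del: mult_Suc mult_Suc_right intro: dvdI)
  show "(case (case x of (n, d) \<Rightarrow> (d - 1, Suc n div d - 1)) of (i, j) \<Rightarrow> (Suc i * Suc j - 1, Suc i)) = x"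
    if mem: "x \<in> Sigma UNIV (\<lambda>n. {d. d dvd Suc n})" for x
  proof -
    obtain n d where nd: "x = (n, d)" "d dvd Suc n" using mem by (cases x) auto
    then obtain e where x: "x = (n, d)" "Suc n = d * e" by (auto elim: dvdE)
    hence "d > 0" "e > 0" by (metis nat_0_less_mult_iff zero_less_Suc)+
    thus ?thesis using x by (simp del: mult_Suc mult_Suc_right)
  qed
  show "(case (case y of (i, j) \<Rightarrow> (Suc i * Suc j - 1, Suc i)) of (n, d) \<Rightarrow> (d - 1, Suc n div d - 1)) = y"
    if "y \<in> UNIV \<times> UNIV" for y
  proof (cases y)
    case (Pair i j)
    have "Suc (Suc i * Suc j - 1) = Suc i * Suc j" by simp
    thus ?thesis using Pair by (simp only: prod.case) (simp del: mult_Suc mult_Suc_right)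
  qed
qed auto

text \<open>A product majorant gives unconditional summability, hence equality of the two iterated
  sums and of the sum grouped by the product of the indices. The last conclusion supplies majorants
  built from divisor sums.\<close>

lemma double_sums:
  fixes f :: "nat \<Rightarrow> nat \<Rightarrow> complex" and p r :: "nat \<Rightarrow> real"
  assumes "summable p" "summable r" "\<And>i. p i \<ge> 0" "\<And>j. r j \<ge> 0"
    and bound: "\<And>i j. norm (f i j) \<le> p i * r j"
  obtains T where "(\<lambda>i. \<Sum>j. f i j) sums T" "(\<lambda>j. \<Sum>i. f i j) sums T"
    "(\<lambda>n. \<Sum>d | d dvd Suc n. f (d - 1) (Suc n div d - 1)) sums T"
    "\<And>i. summable (f i)" "\<And>j. summable (\<lambda>i. f i j)"
    "summable (\<lambda>n. \<Sum>d | d dvd Suc n. norm (f (d - 1) (Suc n div d - 1)))"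
proof -
  have nsum: "(\<lambda>x. norm (case x of (i, j) \<Rightarrow> f i j)) summable_on UNIV \<times> UNIV"
    by (rule Infinite_Sum.abs_summable_on_comparison_test' [OF summable_on_product [OF assms(1-4)]])
      (auto simp: bound)
  hence sm: "(\<lambda>(i,j). f i j) summable_on UNIV \<times> UNIV" by (rule Infinite_Sum.abs_summable_summable)
  then obtain T where T: "((\<lambda>(i,j). f i j) has_sum T) (UNIV \<times> UNIV)" 
    by (auto simp: summable_on_def)
  have row: "(f i) summable_on UNIV" for i using summable_on_SigmaD1 [OF sm] by simp
  have T': "((\<lambda>(j,i). f i j) has_sum T) (UNIV \<times> UNIV)"
    using T by (subst has_sum_swap) simp
  hence "(\<lambda>(j,i). f i j) summable_on UNIV \<times> UNIV" by (auto simp: summable_on_def)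
  from summable_on_SigmaD1 [OF this] have col: "(\<lambda>i. f i j) summable_on UNIV" for j by simp
  have eq: "infsum g UNIV = suminf g" if "g summable_on UNIV" for g :: "nat \<Rightarrow> complex"
    using has_sum_imp_sums [OF has_sum_infsum [OF that]] by (rule sums_unique)
  show ?thesis
  proof
    show "(\<lambda>i. \<Sum>j. f i j) sums T"
      using has_sum_SigmaD [OF T, of "\<lambda>i. suminf (f i)"] has_sum_infsum [OF row]
      by (intro has_sum_imp_sums) (simp add: eq [OF row])
    show "(\<lambda>j. \<Sum>i. f i j) sums T"
      using has_sum_SigmaD [OF T', of "\<lambda>j. suminf (\<lambda>i. f i j)"] has_sum_infsum [OF col]
      by (intro has_sum_imp_sums) (simp add: eq [OF col])
    show "summable (f i)" for i using row by (rule summable_on_imp_summable)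
    show "summable (\<lambda>i. f i j)" for j using col by (rule summable_on_imp_summable)
    have *: "((\<lambda>(n, d). f (d - 1) (Suc n div d - 1)) has_sum T) (Sigma UNIV (\<lambda>n. {d. d dvd Suc n}))"
      using has_sum_reindex_bij_betw [OF bij_betw_dvd_Suc_Sigma, of "\<lambda>(i,j). f i j" T] T
      by (simp add: case_prod_unfold)
    show "(\<lambda>n. \<Sum>d | d dvd Suc n. f (d - 1) (Suc n div d - 1)) sums T"
      by (rule has_sum_imp_sums, rule has_sum_SigmaD [OF *]) (auto intro!: has_sum_finite)
    from nsum obtain S where "((\<lambda>(i,j). norm (f i j)) has_sum S) (UNIV \<times> UNIV)"
      by (auto simp: summable_on_def case_prod_unfold)
    hence *: "((\<lambda>(n, d). norm (f (d - 1) (Suc n div d - 1))) has_sum S) (Sigma UNIV (\<lambda>n. {d. d dvd Suc n}))"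
      using has_sum_reindex_bij_betw [OF bij_betw_dvd_Suc_Sigma, of "\<lambda>(i,j). norm (f i j)" S]
      by (simp add: case_prod_unfold)
    have "(\<lambda>n. \<Sum>d | d dvd Suc n. norm (f (d - 1) (Suc n div d - 1))) sums S"
      by (rule has_sum_imp_sums, rule has_sum_SigmaD [OF *]) (auto intro!: has_sum_finite)
    thus "summable (\<lambda>n. \<Sum>d | d dvd Suc n. norm (f (d - 1) (Suc n div d - 1)))"
      by (simp add: sums_iff)
  qed
qed

text \<open>Partial sums at multiples of \<open>q\<close> converge by hypothesis; any other partial
  sum differs by fewer than \<open>q\<close> terms, each tending to 0. This recovers conditionally
  convergent L-series from their sums over periods.\<close>

lemma sums_of_blocks:
  fixes f :: "nat \<Rightarrow> 'a :: real_normed_vector"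
  assumes "q > 0" and blocks: "(\<lambda>j. \<Sum>h<q. f (j * q + h)) sums S" and "f \<longlonglongrightarrow> 0"
  shows "f sums S"
proof -
  define P where "P n = sum f {..<n}" for n
  have P_add: "P (a + b) = P a + (\<Sum>h<b. f (a + h))" for a b
    unfolding P_def by (induction b) (simp_all add: add_ac)
  have "P (j * q) = (\<Sum>i<j. \<Sum>h<q. f (i * q + h))" for j
  proof (induction j)
    case (Suc j)
    thus ?case using P_add [of "j * q" q] by (simp add: add_ac)
  qed (simp add: P_def)
  hence P: "(\<lambda>j. P (j * q)) \<longlonglongrightarrow> S" using blocks by (simp add: sums_def)
  have div: "filterlim (\<lambda>n. n div q) sequentially sequentially"
    unfolding filterlim_at_top
  proof
    fix Z show "\<forall>\<^sub>F n in sequentially. Z \<le> n div q"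
      using eventually_ge_at_top [of "Z * q"]
      by eventually_elim (use assms(1) in \<open>simp add: less_eq_div_iff_mult_less_eq\<close>)
  qed
  have "(\<lambda>n. P (n div q * q)) \<longlonglongrightarrow> S" by (rule filterlim_compose [OF P div])
  moreover have "(\<lambda>n. P n - P (n div q * q)) \<longlonglongrightarrow> 0"
  proof (rule Lim_null_comparison)
    have mult: "filterlim (\<lambda>n. n div q * q + h) sequentially sequentially" for h
    proof (rule filterlim_at_top_mono [OF div], intro always_eventually allI trans_le_add1)
      show "n div q \<le> n div q * q" for n using assms(1) mult_le_mono2 [of 1 q "n div q"] by simp
    qed
    have "(\<lambda>n. f (n div q * q + h)) \<longlonglongrightarrow> 0" for h
      by (rule filterlim_compose [OF assms(3) mult])
    thus "(\<lambda>n. \<Sum>h<q. norm (f (n div q * q + h))) \<longlonglongrightarrow> 0"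
      by (intro tendsto_null_sum tendsto_norm_zero)
    show "\<forall>\<^sub>F n in sequentially. norm (P n - P (n div q * q)) \<le> (\<Sum>h<q. norm (f (n div q * q + h)))"
    proof (rule always_eventually, rule allI)
      fix n
      from P_add [of "n div q * q" "n mod q"]
      have "P n - P (n div q * q) = (\<Sum>h<n mod q. f (n div q * q + h))" by simp
      also have "norm \<dots> \<le> (\<Sum>h<n mod q. norm (f (n div q * q + h)))" by (rule norm_sum)
      also have "\<dots> \<le> (\<Sum>h<q. norm (f (n div q * q + h)))"
        using assms(1) by (intro sum_mono2) (auto intro: less_trans)
      finally show "norm (P n - P (n div q * q)) \<le> (\<Sum>h<q. norm (f (n div q * q + h)))" .
    qed
  qed
  ultimately have "(\<lambda>n. P (n div q * q) + (P n - P (n div q * q))) \<longlonglongrightarrow> S + 0"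
    by (rule tendsto_add)
  thus ?thesis by (simp add: sums_def P_def)
qed

section \<open>Interchanging the lattice sums\<close>

context odd_primitive_character
begin

text \<open>One period of the lattice sum, l = j*q + h with real part l/q and both signs of the
  imaginary part. Whole periods are kept together so that \<open>sum_chi\<close> acts inside each
  block; starting at h = 1 keeps the real parts positive.\<close>

definition block :: "nat \<Rightarrow> nat \<Rightarrow> real \<Rightarrow> complex" where
  "block k j u = (\<Sum>h=1..<q. chi h *
     (1 / (of_real (j + h / q) + \<i> * of_real u) ^ Suc k
      + 1 / (of_real (j + h / q) - \<i> * of_real u) ^ Suc k))"

text \<open>In the poles with negative imaginary part, replacing h by q - h turns
  \<open>z' h\<close> into \<open>1 - z h\<close> and \<open>chi h\<close> into
  \<open>- chi h\<close>, so each h contributes a polygamma reflection. Its constant disappears by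
  \<open>sum_chi\<close>, and \<open>gauss_separable\<close> evaluates the remaining sum over
  h.\<close>

lemma block_sums:
  assumes "even k" "u > 0"
  shows "(\<lambda>j. block k j u) sums
    (- ((2 * of_real pi * \<i>) ^ Suc k) / fact k * gauss_sum q chi *
      (\<Sum>d. of_nat (Suc d) ^ k * cnj (chi (Suc d)) * of_real (exp (- 2 * pi * u)) ^ Suc d))"
proof -
  define z where "z h = of_real (h / q) + \<i> * of_real u" for h :: nat
  define z' where "z' h = of_real (h / q) - \<i> * of_real u" for h :: nat
  have zj: "z h + of_nat j = of_real (j + h / q) + \<i> * of_real u"
    and z'j: "z' h + of_nat j = of_real (j + h / q) - \<i> * of_real u" for h j
    by (simp_all add: z_def z'_def)
  have nz: "z h \<noteq> 0" "z' h \<noteq> 0" for h using assms(2) by (auto simp: z_def z'_def complex_eq_iff)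
  have "(\<lambda>j. (\<Sum>h=1..<q. chi h / (z h + of_nat j) ^ Suc k) + (\<Sum>h=1..<q. chi h / (z' h + of_nat j) ^ Suc k))
    sums ((-1) ^ Suc k / fact k * (\<Sum>h=1..<q. chi h * Polygamma k (z h)) +
          (-1) ^ Suc k / fact k * (\<Sum>h=1..<q. chi h * Polygamma k (z' h)))"
    by (intro sums_add Polygamma_combination_sums sum_chi finite_atLeastLessThan nz)
  also have "(\<lambda>j. (\<Sum>h=1..<q. chi h / (z h + of_nat j) ^ Suc k) + (\<Sum>h=1..<q. chi h / (z' h + of_nat j) ^ Suc k))
    = (\<lambda>j. block k j u)"
    unfolding zj z'j block_def
    by (simp only: sum.distrib [symmetric] distrib_left mult_1_right times_divide_eq_right)
  also have "(\<Sum>h=1..<q. chi h * Polygamma k (z' h)) = (\<Sum>h=1..<q. chi (q - h) * Polygamma k (z' (q - h)))"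
    by (rule sum.reindex_bij_witness [of _ "\<lambda>h. q - h" "\<lambda>h. q - h"]) auto
  also have "\<dots> = (\<Sum>h=1..<q. - chi h * Polygamma k (1 - z h))"
  proof (intro sum.cong refl)
    fix h assume h: "h \<in> {1..<q}"
    hence "z' (q - h) = 1 - z h" using modulus_gt_1
      by (simp add: z_def z'_def of_nat_diff diff_divide_distrib)
    thus "chi (q - h) * Polygamma k (z' (q - h)) = - chi h * Polygamma k (1 - z h)"
      using h by (simp add: chi_minus)
  qed
  also have "(-1) ^ Suc k / fact k * (\<Sum>h=1..<q. chi h * Polygamma k (z h)) +
      (-1) ^ Suc k / fact k * (\<Sum>h=1..<q. - chi h * Polygamma k (1 - z h)) =
      1 / fact k * (\<Sum>h=1..<q. chi h * (Polygamma k (1 - z h) - Polygamma k (z h)))"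
    using assms(1) by (simp add: right_diff_distrib sum_subtractf sum_negf)
  also have "(\<Sum>h=1..<q. chi h * (Polygamma k (1 - z h) - Polygamma k (z h))) =
      (\<Sum>h=1..<q. chi h * ((if k = 0 then - of_real pi * \<i> else 0)
        - (2 * of_real pi * \<i>) ^ Suc k * power_polylog k (exp (2 * of_real pi * \<i> * z h))))"
  proof (intro sum.cong refl)
    fix h show "chi h * (Polygamma k (1 - z h) - Polygamma k (z h)) = 
      chi h * ((if k = 0 then - of_real pi * \<i> else 0)
        - (2 * of_real pi * \<i>) ^ Suc k * power_polylog k (exp (2 * of_real pi * \<i> * z h)))"
      using Polygamma_reflection [of "z h" k] assms by (simp add: z_def)
  qed
  also have "\<dots> = (\<Sum>h=1..<q. chi h) * (if k = 0 then - of_real pi * \<i> else 0) -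
      (2 * of_real pi * \<i>) ^ Suc k * (\<Sum>h=1..<q. chi h * power_polylog k (exp (2 * of_real pi * \<i> * z h)))"
    by (simp only: right_diff_distrib sum_subtractf sum_distrib_left sum_distrib_right mult_ac)
  also have "(\<Sum>h=1..<q. chi h * power_polylog k (exp (2 * of_real pi * \<i> * z h))) =
      gauss_sum q chi * (\<Sum>d. of_nat (Suc d) ^ k * cnj (chi (Suc d)) * of_real (exp (- 2 * pi * u)) ^ Suc d)"
  proof -
    have w: "exp (2 * of_real pi * \<i> * z h) = unity_exp q h * of_real (exp (- 2 * pi * u))" for h
    proof -
      have "2 * of_real pi * \<i> * z h = 2 * of_real pi * \<i> * of_nat h / of_nat q + of_real (- 2 * pi * u)"
        by (simp add: z_def algebra_simps)
      thus ?thesis by (simp only: unity_exp_def exp_add exp_of_real)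
    qed
    have norm: "norm (exp (2 * of_real pi * \<i> * z h)) < 1" for h
      using assms(2) by (simp add: z_def)
    have "(\<lambda>d. \<Sum>h=1..<q. chi h * (of_nat (Suc d) ^ k * exp (2 * of_real pi * \<i> * z h) ^ Suc d)) sums
        (\<Sum>h=1..<q. chi h * power_polylog k (exp (2 * of_real pi * \<i> * z h)))"
      by (intro sums_sum sums_mult power_polylog_sums norm)
    also have "(\<lambda>d. \<Sum>h=1..<q. chi h * (of_nat (Suc d) ^ k * exp (2 * of_real pi * \<i> * z h) ^ Suc d)) =
        (\<lambda>d. gauss_sum q chi * (of_nat (Suc d) ^ k * cnj (chi (Suc d)) * of_real (exp (- 2 * pi * u)) ^ Suc d))"
    proof
      fix d
      have "(\<Sum>h=1..<q. chi h * (of_nat (Suc d) ^ k * exp (2 * of_real pi * \<i> * z h) ^ Suc d)) =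
        of_nat (Suc d) ^ k * of_real (exp (- 2 * pi * u)) ^ Suc d * (\<Sum>h=1..<q. chi h * unity_exp q (h * Suc d))"
        unfolding w power_mult_distrib unity_exp_mult sum_distrib_left by (simp only: mult_ac)
      also have "(\<Sum>h=1..<q. chi h * unity_exp q (h * Suc d)) = (\<Sum>h<q. chi h * unity_exp q (h * Suc d))"
        by (simp add: sum_lessThan_conv)
      finally show "(\<Sum>h=1..<q. chi h * (of_nat (Suc d) ^ k * exp (2 * of_real pi * \<i> * z h) ^ Suc d)) =
         gauss_sum q chi * (of_nat (Suc d) ^ k * cnj (chi (Suc d)) * of_real (exp (- 2 * pi * u)) ^ Suc d)"
        unfolding gauss_separable by (simp only: mult_ac)
    qed
    finally have S: "(\<lambda>d. gauss_sum q chi * (of_nat (Suc d) ^ k * cnj (chi (Suc d)) * 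
        of_real (exp (- 2 * pi * u)) ^ Suc d)) sums
        (\<Sum>h=1..<q. chi h * power_polylog k (exp (2 * of_real pi * \<i> * z h)))" .
    \<comment> \<open>The summability that \<open>suminf_mult\<close> asks for is recovered by
      cancelling the nonzero Gauss sum.\<close>
    hence "summable (\<lambda>d. of_nat (Suc d) ^ k * cnj (chi (Suc d)) * of_real (exp (- 2 * pi * u)) ^ Suc d)"
      using gauss_sum_nonzero by (auto dest!: sums_summable simp: summable_cmult_iff)
    with sums_unique [OF S] show ?thesis by (simp only: suminf_mult)
  qed
  finally show ?thesis
    by (simp only: sum_chi) (simp add: mult_ac)
qed

text \<open>The Lipschitz formula in the other lattice direction, applied at c = j + h/q; the term
  pi/v of weight one disappears by \<open>sum_chi\<close>.\<close>

lemma block_sums_Suc: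
  assumes "even k" "v > 0"
  shows "(\<lambda>m. block k j (real (Suc m) * v)) sums
    (\<Sum>h=1..<q. chi h * (- 1 / of_real (j + h / q) ^ Suc k
      + of_real (2 * pi / v) ^ Suc k / fact k * power_polylog k (of_real (exp (- 2 * pi * (j + h / q) / v)))))"
proof -
  have "(\<lambda>m. block k j (real (Suc m) * v)) sums (\<Sum>h=1..<q. chi h * 
      ((if k = 0 then of_real (pi / v) else 0) - 1 / of_real (j + h / q) ^ Suc k
       + of_real (2 * pi / v) ^ Suc k / fact k * power_polylog k (of_real (exp (- 2 * pi * (j + h / q) / v)))))"
    unfolding block_def using modulus_gt_1
    by (intro sums_sum sums_mult Lipschitz_sums assms) (auto intro!: add_nonneg_pos)
  also have "(\<Sum>h=1..<q. chi h * 
      ((if k = 0 then of_real (pi / v) else 0) - 1 / of_real (j + h / q) ^ Suc k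
       + of_real (2 * pi / v) ^ Suc k / fact k * power_polylog k (of_real (exp (- 2 * pi * (j + h / q) / v))))) =
      (\<Sum>h=1..<q. chi h) * (if k = 0 then of_real (pi / v) else 0) +
      (\<Sum>h=1..<q. chi h * (- 1 / of_real (j + h / q) ^ Suc k
      + of_real (2 * pi / v) ^ Suc k / fact k * power_polylog k (of_real (exp (- 2 * pi * (j + h / q) / v)))))"
    unfolding sum_distrib_right sum.distrib [symmetric]
    by (intro sum.cong refl) (simp add: algebra_simps del: power_Suc)
  finally show ?thesis by (simp only: sum_chi) (simp del: power_Suc)
qed

end

text \<open>By the inequality 2*a*b \<le> a^2 + b^2 the squared norm is at least a multiple of (j +
  1)*(m + 1), which separates the variables as \<open>double_sums\<close> requires. Each factor 1/w
  is thus worth an exponent -1/2 in both variables, so three of them are summable.\<close>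

lemma lattice_norm_bound:
  fixes w :: complex
  assumes "v > 0" and "Re w \<ge> real j" and "\<bar>Im w\<bar> = real (Suc m) * v"
  shows "inverse (norm w) \<le> 1 / sqrt (min 1 (v\<^sup>2) / 2) * (1 / sqrt (Suc j)) * (1 / sqrt (Suc m))"
proof -
  define K where "K = min 1 (v\<^sup>2)"
  have K: "0 < K" "K \<le> 1" "K \<le> v\<^sup>2" using assms by (auto simp: K_def)
  \<comment> \<open>The shift from j to j + 1 costs an extra b, which is at most b^2 because b \<ge>
    1.\<close>
  have "real (Suc j) * b / 2 \<le> (real j)\<^sup>2 + b\<^sup>2" if "b \<ge> 1" for b
  proof -
    have "2 * real j * b \<le> (real j)\<^sup>2 + b\<^sup>2" by (rule sum_squares_bound)
    moreover have "b \<le> b\<^sup>2" using that by (simp add: self_le_power)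
    moreover have "real (Suc j) * b = real j * b + b" by (simp add: algebra_simps)
    ultimately show ?thesis using that zero_le_power2 [of "real j"] by linarith
  qed
  from this [of "real (Suc m)"]
  have "real (Suc j) * real (Suc m) / 2 \<le> (real j)\<^sup>2 + (real (Suc m))\<^sup>2" by simp
  hence "K * (real (Suc j) * real (Suc m) / 2) \<le> K * ((real j)\<^sup>2 + (real (Suc m))\<^sup>2)"
    using K by (intro mult_left_mono) auto
  also have "\<dots> \<le> 1 * (real j)\<^sup>2 + v\<^sup>2 * (real (Suc m))\<^sup>2"
    unfolding distrib_left using K by (intro add_mono mult_right_mono) auto
  also have "\<dots> \<le> (Re w)\<^sup>2 + \<bar>Im w\<bar>\<^sup>2"
    using assms by (auto simp: power_mult_distrib intro!: add_mono power_mono)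
  finally have "sqrt (K / 2 * real (Suc j) * real (Suc m)) \<le> norm w"
    by (simp add: cmod_def)
  hence "inverse (norm w) \<le> inverse (sqrt (K / 2 * real (Suc j) * real (Suc m)))"
    using K by (intro le_imp_inverse_le) auto
  thus ?thesis by (simp only: K_def real_sqrt_mult inverse_mult_distrib inverse_eq_divide
      times_divide_times_eq mult_1)
qed

lemma summable_inverse_sqrt_cube: "summable (\<lambda>n. (1 / sqrt (Suc n)) ^ 3)"
proof -
  have "summable (\<lambda>n. real n powr (- 3 / 2))" by (simp add: summable_real_powr_iff)
  hence "summable (\<lambda>n. real (Suc n) powr (- 3 / 2))" by (subst summable_Suc_iff)
  moreover have "(1 / sqrt x) ^ 3 = x powr (- 3 / 2)" if "x > 0" for x
  proof -
    have "(1 / sqrt x) ^ 3 = (x powr (- 1 / 2)) ^ 3"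
      using that by (simp add: powr_half_sqrt [symmetric] powr_minus_divide)
    also have "\<dots> = x powr (- 3 / 2)" using that by (simp add: powr_power)
    finally show ?thesis .
  qed
  ultimately show ?thesis by simp
qed

text \<open>As \<open>s\<close> and \<open>t\<close> are at most 1, their exponents may be lowered
  to 3, so one kind of majorant serves all larger weights.\<close>

lemma power_le_cube_bound:
  fixes a K s t :: real
  assumes "0 \<le> a" "a \<le> K * s * t" "K \<ge> 0" "0 \<le> s" "s \<le> 1" "0 \<le> t" "t \<le> 1" "N \<ge> 3"
  shows "a ^ N \<le> K ^ N * s ^ 3 * t ^ 3"
proof -
  have "a ^ N \<le> (K * s * t) ^ N" using assms by (intro power_mono) auto
  also have "\<dots> = K ^ N * s ^ N * t ^ N" by (simp add: power_mult_distrib)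
  also have "\<dots> \<le> K ^ N * s ^ 3 * t ^ 3"
    using assms by (intro mult_mono [OF mult_left_mono [OF power_decreasing] power_decreasing]) auto
  finally show ?thesis .
qed

context odd_primitive_character
begin

text \<open>Here the exponent k + 1 is at least 3, just enough for the bound by half powers to be
  summable in both variables.\<close>

lemma block_swap_pos:
  assumes "k > 1" and v: "v > 0"
  obtains T where "(\<lambda>m. \<Sum>j. block k j (real (Suc m) * v)) sums T"
    "(\<lambda>j. \<Sum>m. block k j (real (Suc m) * v)) sums T"
proof -
  define K where "K = 1 / sqrt (min 1 (v\<^sup>2) / 2)"
  have K: "K \<ge> 0" using v by (simp add: K_def)
  define s where "s n = 1 / sqrt (real (Suc n))" for n
  have s: "0 \<le> s n" "s n \<le> 1" for n by (auto simp: s_def)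
  have bnd: "norm (block k j (real (Suc m) * v)) \<le> (2 * real q * K ^ Suc k * s j ^ 3) * s m ^ 3" for j m
  proof -
    have b: "norm (1 / w ^ Suc k) \<le> K ^ Suc k * s j ^ 3 * s m ^ 3"
      if "Re w \<ge> real j" "\<bar>Im w\<bar> = real (Suc m) * v" for w
    proof -
      have "inverse (norm w) ^ Suc k \<le> K ^ Suc k * s j ^ 3 * s m ^ 3"
        using lattice_norm_bound [OF v that] assms(1) K s
        by (intro power_le_cube_bound) (auto simp: K_def s_def)
      thus ?thesis by (simp add: norm_divide norm_power power_one_over inverse_eq_divide del: power_Suc)
    qed
    have "norm (block k j (real (Suc m) * v)) \<le> (\<Sum>h=1..<q. 1 * (K ^ Suc k * s j ^ 3 * s m ^ 3 + K ^ Suc k * s j ^ 3 * s m ^ 3))"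
      unfolding block_def using v
      by (intro sum_norm_le order.trans [OF norm_mult_ineq] mult_mono norm_chi_le
          order.trans [OF norm_triangle_ineq] add_mono b) (auto simp: abs_mult)
    also have "\<dots> = 2 * real (q - 1) * (K ^ Suc k * s j ^ 3 * s m ^ 3)" by (simp add: algebra_simps)
    also have "\<dots> \<le> 2 * real q * (K ^ Suc k * s j ^ 3 * s m ^ 3)"
      using K s by (intro mult_right_mono) auto
    finally show ?thesis by (simp only: mult_ac)
  qed
  have sm: "summable (\<lambda>j. 2 * real q * K ^ Suc k * s j ^ 3)" "summable (\<lambda>m. s m ^ 3)"
    unfolding s_def by (intro summable_mult summable_inverse_sqrt_cube)+
  have nn: "2 * real q * K ^ Suc k * s j ^ 3 \<ge> 0" "s j ^ 3 \<ge> 0" for j using K s by simp_all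
  show ?thesis
  proof (rule double_sums [OF sm nn bnd])
    fix T assume "(\<lambda>j. \<Sum>m. block k j (real (Suc m) * v)) sums T"
      "(\<lambda>m. \<Sum>j. block k j (real (Suc m) * v)) sums T"
    thus ?thesis by (intro that)
  qed
qed

text \<open>The character-weighted remainder of linear interpolation of 1/w between the ends of a
  block. Its denominators have three factors of lattice size, the least number for which
  \<open>lattice_norm_bound\<close> yields a summable majorant.\<close>

definition block_error :: "nat \<Rightarrow> real \<Rightarrow> complex" where
  "block_error j u = (\<Sum>h=1..<q. chi h * of_real (h / q) * of_real (h / q - 1) *
     (1 / ((of_real j + \<i> * of_real u) * (of_real (j + h / q) + \<i> * of_real u) * (of_real (j + 1) + \<i> * of_real u))
     + 1 / ((of_real j - \<i> * of_real u) * (of_real (j + h / q) - \<i> * of_real u) * (of_real (j + 1) - \<i> * of_real u))))"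

text \<open>For nonzero \<open>u\<close> this is 2*j/(j^2 + u^2); in particular it vanishes at
  \<open>j = 0\<close>.\<close>

definition pole_pair :: "nat \<Rightarrow> real \<Rightarrow> complex" where
  "pole_pair j u = 1 / (of_nat j + \<i> * of_real u) + 1 / (of_nat j - \<i> * of_real u)"

text \<open>For weight one the lattice sum is only conditionally convergent. Subtracting from each
  pole the linear interpolation between the two ends of its block leaves an absolutely convergent
  error, because the values of the character sum to zero; the interpolant telescopes.\<close>

lemma block_0_eq:
  assumes "u > 0"
  shows "block 0 j u = block_error j u +
    (\<Sum>h=1..<q. chi h * of_real (h / q)) * (pole_pair (Suc j) u - pole_pair j u)"
proof -
  \<comment> \<open>The remainder of linear interpolation of 1/w on the segment from z to z + 1,
    evaluated at z + a.\<close>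
  have interp: "1 / (z + a) = a * (a - 1) * (1 / (z * (z + a) * (z + 1))) + a * (1 / (z + 1) - 1 / z) + 1 / z"
    if "z \<noteq> 0" "z + a \<noteq> 0" "z + 1 \<noteq> 0" for z a :: complex
    using that by (simp add: divide_simps) (simp add: algebra_simps)
  define z where "z = of_nat j + \<i> * of_real u"
  define z' where "z' = of_nat j - \<i> * of_real u"
  have zh: "z + of_real (h / q) = of_real (j + h / q) + \<i> * of_real u"
    and z'h: "z' + of_real (h / q) = of_real (j + h / q) - \<i> * of_real u" for h :: nat
    by (simp_all add: z_def z'_def)
  have nz: "z + of_real a \<noteq> 0" "z' + of_real a \<noteq> 0" for a
    using assms by (auto simp: z_def z'_def complex_eq_iff)
  have nz': "z \<noteq> 0" "z' \<noteq> 0" "z + 1 \<noteq> 0" "z' + 1 \<noteq> 0"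
    using nz [of 0] nz [of 1] by auto
  have z1: "of_real (real j + 1) + \<i> * of_real u = z + 1"
    "of_real (real j + 1) - \<i> * of_real u = z' + 1" 
    "of_real (real j) + \<i> * of_real u = z" "of_real (real j) - \<i> * of_real u = z'"
    by (simp_all add: z_def z'_def)
  have err: "block_error j u = (\<Sum>h=1..<q. chi h * of_real (h / q) * (of_real (h / q) - 1) *
      (1 / (z * (z + of_real (h / q)) * (z + 1)) + 1 / (z' * (z' + of_real (h / q)) * (z' + 1))))"
    unfolding block_error_def z1 zh z'h by simp
  have pp: "pole_pair (Suc j) u = 1 / (z + 1) + 1 / (z' + 1)" "pole_pair j u = 1 / z + 1 / z'"
    by (simp_all add: pole_pair_def z_def z'_def add_ac diff_add_eq)
  have "block 0 j u = (\<Sum>h=1..<q. chi h * (1 / (z + of_real (h / q)) + 1 / (z' + of_real (h / q))))"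
    unfolding zh z'h block_def by simp
  also have "\<dots> = (\<Sum>h=1..<q. chi h * of_real (h / q) * (of_real (h / q) - 1) *
      (1 / (z * (z + of_real (h / q)) * (z + 1)) + 1 / (z' * (z' + of_real (h / q)) * (z' + 1)))
      + chi h * of_real (h / q) * ((1 / (z + 1) + 1 / (z' + 1)) - (1 / z + 1 / z'))
      + chi h * (1 / z + 1 / z'))"
  proof (intro sum.cong refl)
    fix h
    show "chi h * (1 / (z + of_real (h / q)) + 1 / (z' + of_real (h / q))) =
      chi h * of_real (h / q) * (of_real (h / q) - 1) *
      (1 / (z * (z + of_real (h / q)) * (z + 1)) + 1 / (z' * (z' + of_real (h / q)) * (z' + 1)))
      + chi h * of_real (h / q) * ((1 / (z + 1) + 1 / (z' + 1)) - (1 / z + 1 / z'))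
      + chi h * (1 / z + 1 / z')"
      by (subst (1 2) interp) (simp_all only: nz nz' not_False_eq_True, simp only: algebra_simps)
  qed
  also have "\<dots> = block_error j u + (\<Sum>h=1..<q. chi h * of_real (h / q)) * (pole_pair (Suc j) u - pole_pair j u)
      + (\<Sum>h=1..<q. chi h) * (1 / z + 1 / z')"
    unfolding sum.distrib sum_distrib_right [symmetric] err pp by (rule refl)
  finally show ?thesis by (simp only: sum_chi) simp
qed

text \<open>The three denominators are bounded separately, which gives the same majorant as exponent
  3. The summabilities in each variable are exported so that the telescoping part can be added
  back.\<close>

lemma block_error_swap:
  assumes v: "v > 0"
  obtains T where "(\<lambda>m. \<Sum>j. block_error j (real (Suc m) * v)) sums T"
    "(\<lambda>j. \<Sum>m. block_error j (real (Suc m) * v)) sums T"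
    "\<And>j. summable (\<lambda>m. block_error j (real (Suc m) * v))"
    "\<And>m. summable (\<lambda>j. block_error j (real (Suc m) * v))"
proof -
  define K where "K = 1 / sqrt (min 1 (v\<^sup>2) / 2)"
  have K: "K \<ge> 0" using v by (simp add: K_def)
  define s where "s n = 1 / sqrt (real (Suc n))" for n
  have s: "0 \<le> s n" "s n \<le> 1" for n by (auto simp: s_def)
  have bnd: "norm (block_error j (real (Suc m) * v)) \<le> (2 * real q * K ^ 3 * s j ^ 3) * s m ^ 3" for j m
  proof -
    have b: "norm (1 / (w1 * w2 * w3)) \<le> K ^ 3 * s j ^ 3 * s m ^ 3"
      if "Re w1 \<ge> real j" "\<bar>Im w1\<bar> = real (Suc m) * v" "Re w2 \<ge> real j" "\<bar>Im w2\<bar> = real (Suc m) * v"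
         "Re w3 \<ge> real j" "\<bar>Im w3\<bar> = real (Suc m) * v" for w1 w2 w3
    proof -
      have le: "inverse (norm w) \<le> K * s j * s m" 
        if "Re w \<ge> real j" "\<bar>Im w\<bar> = real (Suc m) * v" for w
        using lattice_norm_bound [OF v that] by (simp add: K_def s_def)
      have "norm (1 / (w1 * w2 * w3)) = inverse (norm w1) * inverse (norm w2) * inverse (norm w3)"
        by (simp add: norm_divide norm_mult field_simps)
      also have "\<dots> \<le> (K * s j * s m) * (K * s j * s m) * (K * s j * s m)"
        using K s that by (intro mult_mono le) auto
      finally show ?thesis by (simp add: power3_eq_cube mult_ac)
    qed
    have "norm (block_error j (real (Suc m) * v)) \<le> (\<Sum>h=1..<q. 1 * 1 * 1 * (K ^ 3 * s j ^ 3 * s m ^ 3 + K ^ 3 * s j ^ 3 * s m ^ 3))"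
      unfolding block_error_def
      using v
      by (intro sum_norm_le order.trans [OF norm_mult_ineq] mult_mono norm_chi_le
          order.trans [OF norm_triangle_ineq] add_mono b)
        (auto simp: abs_mult norm_of_real simp del: of_real_divide of_real_diff)
    also have "\<dots> = 2 * real (q - 1) * (K ^ 3 * s j ^ 3 * s m ^ 3)" by (simp add: algebra_simps)
    also have "\<dots> \<le> 2 * real q * (K ^ 3 * s j ^ 3 * s m ^ 3)"
      using K s by (intro mult_right_mono) auto
    finally show ?thesis by (simp only: mult_ac)
  qed
  have sm: "summable (\<lambda>j. 2 * real q * K ^ 3 * s j ^ 3)" "summable (\<lambda>m. s m ^ 3)"
    unfolding s_def by (intro summable_mult summable_inverse_sqrt_cube)+
  have nn: "2 * real q * K ^ 3 * s j ^ 3 \<ge> 0" "s j ^ 3 \<ge> 0" for j using K s by simp_all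
  show ?thesis
  proof (rule double_sums [OF sm nn bnd])
    fix T assume "(\<lambda>j. \<Sum>m. block_error j (real (Suc m) * v)) sums T"
      "(\<lambda>m. \<Sum>j. block_error j (real (Suc m) * v)) sums T"
      "\<And>j. summable (\<lambda>m. block_error j (real (Suc m) * v))"
      "\<And>m. summable (\<lambda>j. block_error j (real (Suc m) * v))"
    thus ?thesis by (intro that)
  qed
qed

text \<open>Both ends vanish, at \<open>j = 0\<close> and in the limit: summed over j first, the
  interpolant contributes nothing.\<close>

lemma pole_pair_telescope:
  assumes "u > 0"
  shows "(\<lambda>j. pole_pair (Suc j) u - pole_pair j u) sums 0"
proof -
  have "(\<lambda>j. pole_pair j u) \<longlonglongrightarrow> 0"
  proof -
    have "(\<lambda>n. inverse (of_nat n + z)) \<longlonglongrightarrow> 0" for z :: complex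
      by (intro tendsto_inverse_0 [THEN filterlim_compose]
          tendsto_add_filterlim_at_infinity' [OF _ tendsto_const] tendsto_of_nat)
    from tendsto_add [OF this [of "\<i> * of_real u"] this [of "- \<i> * of_real u"]]
    show ?thesis by (simp add: pole_pair_def [abs_def] field_simps)
  qed
  from telescope_sums [OF this] show ?thesis by (simp add: pole_pair_def)
qed

text \<open>Summed over m first, the interpolant is governed by these values: 0 at
  \<open>j = 0\<close>, but tending to pi/v as j grows.\<close>

lemma pole_pair_sums:
  assumes "v > 0"
  shows "(\<lambda>m. pole_pair j (real (Suc m) * v)) sums (if j = 0 then 0 else 
    of_real (pi / v) - 1 / of_nat j + of_real (2 * pi / v) * power_polylog 0 (of_real (exp (- 2 * pi * j / v))))"
proof (cases "j = 0")
  case True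
  thus ?thesis by (simp add: pole_pair_def)
next
  case False
  thus ?thesis using Lipschitz_sums [of 0 "real j" v] assms by (simp add: pole_pair_def)
qed

text \<open>For positive \<open>k\<close> the two orders agree. At \<open>k = 0\<close> the
  interpolant contributes 0 in one order and a multiple of 1/v in the other. \<open>S\<close> does
  not depend on \<open>v\<close>; its value is left open here.\<close>

lemma block_swap:
  assumes "even k"
  obtains S where "\<And>v. v > 0 \<Longrightarrow> \<exists>T. (\<lambda>m. \<Sum>j. block k j (real (Suc m) * v)) sums T \<and>
    (\<lambda>j. \<Sum>m. block k j (real (Suc m) * v)) sums (T + (if k = 0 then S / of_real v else 0))"
proof (cases "k = 0")
  case False
  hence "k > 1" using assms by (cases "k = 1") auto
  show ?thesis
  proof (rule that)
    fix v :: real assume "v > 0"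
    show "\<exists>T. (\<lambda>m. \<Sum>j. block k j (real (Suc m) * v)) sums T \<and>
      (\<lambda>j. \<Sum>m. block k j (real (Suc m) * v)) sums (T + (if k = 0 then 0 / of_real v else 0))"
      using block_swap_pos [OF \<open>k > 1\<close> \<open>v > 0\<close>] by auto
  qed
next
  case True
  define S where "S = (\<Sum>h=1..<q. chi h * of_real (h / q))"
  show ?thesis
  proof (rule that)
    fix v :: real assume v: "v > 0"
    obtain T where T: "(\<lambda>m. \<Sum>j. block_error j (real (Suc m) * v)) sums T"
      "(\<lambda>j. \<Sum>m. block_error j (real (Suc m) * v)) sums T"
      "\<And>j. summable (\<lambda>m. block_error j (real (Suc m) * v))"
      "\<And>m. summable (\<lambda>j. block_error j (real (Suc m) * v))"
      using block_error_swap [OF v] by metis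
    have eq: "block k j (real (Suc m) * v) = block_error j (real (Suc m) * v) +
       S * (pole_pair (Suc j) (real (Suc m) * v) - pole_pair j (real (Suc m) * v))" for j m
      using v True unfolding S_def by (simp only: block_0_eq mult_pos_pos of_nat_0_less_iff zero_less_Suc)
    define R where "R j = (\<Sum>m. pole_pair j (real (Suc m) * v))" for j
    have R_sums: "(\<lambda>m. pole_pair j (real (Suc m) * v)) sums R j" for j
      using sums_summable [OF pole_pair_sums [OF v, of j]] unfolding R_def by (rule summable_sums)
    have row: "(\<Sum>j. block k j (real (Suc m) * v)) = (\<Sum>j. block_error j (real (Suc m) * v))" for m
    proof -
      have "(\<lambda>j. block k j (real (Suc m) * v)) sums ((\<Sum>j. block_error j (real (Suc m) * v)) + S * 0)"
        unfolding eq using v by (intro sums_add sums_mult pole_pair_telescope summable_sums T) auto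
      thus ?thesis by (simp add: sums_iff)
    qed
    have col: "(\<Sum>m. block k j (real (Suc m) * v)) =
        (\<Sum>m. block_error j (real (Suc m) * v)) + S * (R (Suc j) - R j)" for j
    proof -
      have "(\<lambda>m. block k j (real (Suc m) * v)) sums
          ((\<Sum>m. block_error j (real (Suc m) * v)) + S * (R (Suc j) - R j))"
        unfolding eq by (intro sums_add sums_mult sums_diff R_sums summable_sums T)
      thus ?thesis by (simp add: sums_iff)
    qed
    \<comment> \<open>Against \<open>R 0 = 0\<close>, this limit is the whole discrepancy between
      the two orders of summation.\<close>
    have "R \<longlonglongrightarrow> of_real (pi / v)"
    proof (rule Lim_transform_eventually)
      have lim: "(\<lambda>j. complex_of_real (exp (- 2 * pi * real j / v))) \<longlonglongrightarrow> 0"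
      proof -
        have "filterlim (\<lambda>j. real j * (2 * pi / v)) at_top sequentially"
          using v by (intro filterlim_at_top_mult_tendsto_pos [OF tendsto_const] filterlim_real_sequentially) auto
        hence "(\<lambda>j. exp (- (real j * (2 * pi / v)))) \<longlonglongrightarrow> 0"
          by (intro filterlim_compose [OF exp_at_bot] filterlim_uminus_at_bot [THEN iffD2]) simp
        from tendsto_of_real [OF this, where 'a = complex] show ?thesis by (simp add: mult_ac)
      qed
      have "(\<lambda>j. of_real (pi / v) - inverse (of_nat j) + of_real (2 * pi / v) * 
          (of_real (exp (- 2 * pi * real j / v)) / (1 - of_real (exp (- 2 * pi * real j / v)))))
          \<longlonglongrightarrow> of_real (pi / v) - 0 + of_real (2 * pi / v) * (0 / (1 - 0) :: complex)"
        by (intro tendsto_intros lim lim_inverse_n) simp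
      thus "(\<lambda>j. of_real (pi / v) - inverse (of_nat j) + of_real (2 * pi / v) * 
          (of_real (exp (- 2 * pi * real j / v)) / (1 - of_real (exp (- 2 * pi * real j / v)))))
          \<longlonglongrightarrow> complex_of_real (pi / v)" by simp
      show "\<forall>\<^sub>F j in sequentially. of_real (pi / v) - inverse (of_nat j) + of_real (2 * pi / v) * 
          (of_real (exp (- 2 * pi * real j / v)) / (1 - of_real (exp (- 2 * pi * real j / v)))) = R j"
        using eventually_gt_at_top [of 0]
      proof eventually_elim
        case (elim j)
        hence "norm (complex_of_real (exp (- 2 * pi * real j / v))) < 1" using v by simp
        thus ?case using sums_unique2 [OF R_sums pole_pair_sums [OF v]] elim
          by (simp add: power_polylog_0 inverse_eq_divide)
      qed
    qed
    from telescope_sums [OF this] have "(\<lambda>j. R (Suc j) - R j) sums (of_real (pi / v) - R 0)" .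
    moreover have "R 0 = 0" using sums_unique2 [OF R_sums pole_pair_sums [OF v]] by simp
    ultimately have "(\<lambda>j. (\<Sum>m. block_error j (real (Suc m) * v)) + S * (R (Suc j) - R j)) sums
        (T + S * of_real (pi / v))"
      by (intro sums_add sums_mult T) simp
    hence "(\<lambda>j. \<Sum>m. block k j (real (Suc m) * v)) sums (T + S * of_real pi / of_real v)"
      unfolding col by simp
    with T(1) show "\<exists>T. (\<lambda>m. \<Sum>j. block k j (real (Suc m) * v)) sums T \<and>
      (\<lambda>j. \<Sum>m. block k j (real (Suc m) * v)) sums (T + (if k = 0 then S * of_real pi / of_real v else 0))"
      unfolding row using True by auto
  qed
qed

end

section \<open>Transformation of the Eisenstein series\<close>

definition sigma_exp_series :: "nat \<Rightarrow> (nat \<Rightarrow> complex) \<Rightarrow> real \<Rightarrow> complex" where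
  "sigma_exp_series k chi y = (\<Sum>n. sigma_chi k chi (Suc n) * of_real (exp (- (real (Suc n) * y))))"

definition sigma_bar_exp_series :: "nat \<Rightarrow> (nat \<Rightarrow> complex) \<Rightarrow> real \<Rightarrow> complex" where
  "sigma_bar_exp_series k chi y = (\<Sum>n. sigma_bar_chi k chi (Suc n) * of_real (exp (- (real (Suc n) * y))))"

text \<open>For positive integers the product is at least the arithmetic mean, so the exponential of
  a product is bounded by a product of geometric terms.\<close>

lemma exp_product_le:
  assumes "y > 0"
  shows "exp (- (real (Suc i) * real (Suc j) * y)) \<le> exp (- y / 2) ^ Suc i * exp (- y / 2) ^ Suc j"
proof -
  have "((1 + a) + (1 + b)) / 2 \<le> (1 + a) * (1 + b)" if "a \<ge> 0" "b \<ge> 0" for a b :: real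
  proof -
    have "(1 + a) * (1 + b) - ((1 + a) + (1 + b)) / 2 = a * b + (a + b) / 2" by (simp add: field_simps)
    moreover have "a * b + (a + b) / 2 \<ge> 0" using that by simp
    ultimately show ?thesis by linarith
  qed
  hence "(real (Suc i) + real (Suc j)) / 2 \<le> real (Suc i) * real (Suc j)"
    by (simp only: of_nat_Suc of_nat_0_le_iff)
  hence "(real (Suc i) + real (Suc j)) / 2 * y \<le> real (Suc i) * real (Suc j) * y"
    using assms by (intro mult_right_mono) auto
  hence "exp (- (real (Suc i) * real (Suc j) * y)) \<le> exp (real (Suc i) * (- y / 2) + real (Suc j) * (- y / 2))"
    by (simp add: algebra_simps add_divide_distrib)
  thus ?thesis by (simp only: exp_add exp_of_nat_mult)
qed

lemma dvd_Suc_props: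
  assumes "d dvd Suc n"
  shows "Suc (d - 1) = d" "Suc (Suc n div d - 1) = Suc n div d" "real d * real (Suc n div d) = real (Suc n)"
proof -
  obtain e where e: "Suc n = d * e" using assms by (auto elim: dvdE)
  hence "d > 0" "e > 0" by (metis nat_0_less_mult_iff zero_less_Suc)+
  thus "Suc (d - 1) = d" "Suc (Suc n div d - 1) = Suc n div d" "real d * real (Suc n div d) = real (Suc n)"
    unfolding e by simp_all
qed

text \<open>One double series serves both divisor sums: the character is placed in \<open>a\<close>
  for \<open>sigma_chi\<close> and in \<open>b\<close> for \<open>sigma_bar_chi\<close>, the other
  coefficient being 1.\<close>

lemma exp_series_double_sums:
  fixes a b :: "nat \<Rightarrow> complex" and k :: nat
  assumes "y > 0" "\<And>n. norm (a n) \<le> 1" "\<And>n. norm (b n) \<le> 1"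
  defines "f \<equiv> \<lambda>i j. of_nat (Suc i) ^ k * a (Suc i) * b (Suc j) * of_real (exp (- (real (Suc i) * real (Suc j) * y)))"
  obtains T where "(\<lambda>i. \<Sum>j. f i j) sums T" "(\<lambda>j. \<Sum>i. f i j) sums T"
    "(\<lambda>n. (\<Sum>d | d dvd Suc n. of_nat d ^ k * a d * b (Suc n div d)) * of_real (exp (- (real (Suc n) * y)))) sums T"
proof -
  define e where "e = exp (- y / 2)"
  have e: "norm e < 1" "e > 0" using assms(1) by (simp_all add: e_def)
  have bnd: "norm (f i j) \<le> (real (Suc i) ^ k * e ^ Suc i) * (e ^ Suc j)" for i j
  proof -
    have "norm (f i j) = real (Suc i) ^ k * norm (a (Suc i)) * norm (b (Suc j)) * exp (- (real (Suc i) * real (Suc j) * y))"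
      unfolding f_def by (simp only: norm_mult norm_power norm_of_nat norm_of_real abs_exp_cancel)
    also have "\<dots> \<le> real (Suc i) ^ k * 1 * 1 * (e ^ Suc i * e ^ Suc j)"
      unfolding e_def by (intro mult_mono exp_product_le assms) auto
    finally show ?thesis by (simp only: mult_ac mult_1)
  qed
  have "summable (\<lambda>i. norm (real (Suc i) ^ k * e ^ Suc i))"
    "summable (\<lambda>i. norm (real (Suc i) ^ 0 * e ^ Suc i))"
    by (intro summable_power_polylog e)+
  hence sm: "summable (\<lambda>i. real (Suc i) ^ k * e ^ Suc i)" "summable (\<lambda>i. e ^ Suc i)"
    using e(2) by (simp_all add: abs_mult)
  have nn: "real (Suc i) ^ k * e ^ Suc i \<ge> 0" "e ^ Suc i \<ge> 0" for i using e(2) by simp_all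
  show ?thesis
  proof (rule double_sums [OF sm nn bnd])
    fix T assume T: "(\<lambda>i. \<Sum>j. f i j) sums T" "(\<lambda>j. \<Sum>i. f i j) sums T"
      "(\<lambda>n. \<Sum>d | d dvd Suc n. f (d - 1) (Suc n div d - 1)) sums T"
    have "(\<Sum>d | d dvd Suc n. f (d - 1) (Suc n div d - 1)) =
      (\<Sum>d | d dvd Suc n. of_nat d ^ k * a d * b (Suc n div d)) * of_real (exp (- (real (Suc n) * y)))" for n
      unfolding sum_distrib_right
      by (intro sum.cong refl) (simp only: mem_Collect_eq f_def dvd_Suc_props)
    with T show ?thesis by (intro that) simp_all
  qed
qed

text \<open>The first form is the one in which \<open>block_sums\<close> delivers the series, the
  second the one integrated termwise.\<close>

lemma sigma_exp_series_sums:
  assumes "y > 0" "\<And>n. norm (chi n) \<le> 1"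
  shows "(\<lambda>m. \<Sum>d. of_nat (Suc d) ^ k * chi (Suc d) * of_real (exp (- (real (Suc m) * y))) ^ Suc d)
    sums sigma_exp_series k chi y"
    and "(\<lambda>n. sigma_chi k chi (Suc n) * of_real (exp (- (real (Suc n) * y)))) sums sigma_exp_series k chi y"
proof -
  obtain T where T: "(\<lambda>m. \<Sum>d. of_nat (Suc d) ^ k * chi (Suc d) * 1 * of_real (exp (- (real (Suc d) * real (Suc m) * y)))) sums T"
    "(\<lambda>n. (\<Sum>d | d dvd Suc n. of_nat d ^ k * chi d * 1) * of_real (exp (- (real (Suc n) * y)))) sums T"
    by (rule exp_series_double_sums [of y chi "\<lambda>_. 1" k]) (use assms in auto)
  hence "T = sigma_exp_series k chi y"
    by (simp add: sums_iff sigma_exp_series_def sigma_chi_def)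
  moreover have "complex_of_real (exp (- (real (Suc d) * real (Suc m) * y))) = of_real (exp (- (real (Suc m) * y))) ^ Suc d" for d m
    by (simp only: of_real_power [symmetric] exp_of_nat_mult [symmetric]) (simp add: algebra_simps)
  ultimately show "(\<lambda>m. \<Sum>d. of_nat (Suc d) ^ k * chi (Suc d) * of_real (exp (- (real (Suc m) * y))) ^ Suc d)
      sums sigma_exp_series k chi y"
    and "(\<lambda>n. sigma_chi k chi (Suc n) * of_real (exp (- (real (Suc n) * y)))) sums sigma_exp_series k chi y"
    using T by (simp_all only: sigma_chi_def mult_1_right)
qed

lemma sigma_bar_exp_series_sums:
  assumes "y > 0" "\<And>n. norm (chi n) \<le> 1"
  shows "(\<lambda>l. chi (Suc l) * power_polylog k (of_real (exp (- (real (Suc l) * y)))))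
    sums sigma_bar_exp_series k chi y"
    and "(\<lambda>n. sigma_bar_chi k chi (Suc n) * of_real (exp (- (real (Suc n) * y)))) sums sigma_bar_exp_series k chi y"
proof -
  obtain T where T: "(\<lambda>l. \<Sum>d. of_nat (Suc d) ^ k * 1 * chi (Suc l) * of_real (exp (- (real (Suc d) * real (Suc l) * y)))) sums T"
    "(\<lambda>n. (\<Sum>d | d dvd Suc n. of_nat d ^ k * 1 * chi (Suc n div d)) * of_real (exp (- (real (Suc n) * y)))) sums T"
    by (rule exp_series_double_sums [of y "\<lambda>_. 1" chi k]) (use assms in auto)
  hence "T = sigma_bar_exp_series k chi y"
    by (simp add: sums_iff sigma_bar_exp_series_def sigma_bar_chi_def)
  moreover have "(\<Sum>d. of_nat (Suc d) ^ k * 1 * chi (Suc l) * of_real (exp (- (real (Suc d) * real (Suc l) * y)))) =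
      chi (Suc l) * power_polylog k (of_real (exp (- (real (Suc l) * y))))" for l
  proof -
    have e: "complex_of_real (exp (- (real (Suc d) * real (Suc l) * y))) = of_real (exp (- (real (Suc l) * y))) ^ Suc d" for d
      by (simp only: of_real_power [symmetric] exp_of_nat_mult [symmetric]) (simp add: algebra_simps)
    have "norm (complex_of_real (exp (- (real (Suc l) * y)))) < 1" using assms(1) by simp
    from sums_unique [OF sums_mult [OF power_polylog_sums [OF this, of k], of "chi (Suc l)"]]
    show ?thesis unfolding e by (simp only: mult_1_right mult.assoc mult.left_commute [of "chi (Suc l)"])
  qed
  ultimately show "(\<lambda>l. chi (Suc l) * power_polylog k (of_real (exp (- (real (Suc l) * y)))))
    sums sigma_bar_exp_series k chi y"
    and "(\<lambda>n. sigma_bar_chi k chi (Suc n) * of_real (exp (- (real (Suc n) * y)))) sums sigma_bar_exp_series k chi y"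
    using T by (simp_all only: sigma_bar_chi_def mult_1_right)
qed

text \<open>Complementary divisors. In weight one the dual series is therefore of the same kind as
  the original, which permits iterating the transformation.\<close>

lemma sigma_bar_chi_0: "n > 0 \<Longrightarrow> sigma_bar_chi 0 chi n = sigma_chi 0 chi n"
  unfolding sigma_bar_chi_def sigma_chi_def
  by (rule sum.reindex_bij_witness [of _ "\<lambda>d. n div d" "\<lambda>d. n div d"])
    (auto elim!: dvdE)

text \<open>The extra term at n = 0 is a division by zero, hence 0, because
  \<open>N > 0\<close>.\<close>

lemma dirichlet_L_eqI:
  assumes "(\<lambda>n. chi n / of_nat n ^ N) sums S" and "N > 0"
  shows "dirichlet_L chi (of_nat N) = S"
proof -
  have "(\<lambda>M. \<Sum>n<Suc M. chi n / of_nat n ^ N) \<longlonglongrightarrow> S"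
    using assms(1) unfolding sums_def by (rule LIMSEQ_Suc)
  also have "(\<lambda>M. \<Sum>n<Suc M. chi n / of_nat n ^ N) = (\<lambda>M. \<Sum>n=1..M. chi n / of_nat n powr of_nat N)"
  proof
    fix M
    have "{..<Suc M} = insert 0 {1..M}" by auto
    moreover have "(\<Sum>n=1..M. chi n / of_nat n ^ N) = (\<Sum>n=1..M. chi n / of_nat n powr of_nat N)"
      by (intro sum.cong refl) (auto simp: powr_nat')
    ultimately show "(\<Sum>n<Suc M. chi n / of_nat n ^ N) = (\<Sum>n=1..M. chi n / of_nat n powr of_nat N)"
      using assms(2) by (simp del: lessThan_Suc)
  qed
  finally show ?thesis unfolding dirichlet_L_def by (rule limI)
qed

context odd_primitive_character
begin

text \<open>Summing the lattice sum of the conjugate character over j first gives the series for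
  \<open>chi\<close>; summing over m first gives the L-value and the dual series. \<open>C\<close>
  absorbs the still unidentified correction from \<open>block_swap\<close>.\<close>

lemma sigma_exp_series_transform_aux:
  assumes "even k"
  obtains C where "\<And>y. y > 0 \<Longrightarrow> sigma_exp_series k chi y =
    (if k = 0 then C / of_real y else 0)
    - fact k * gauss_sum q chi * of_nat q ^ k / (2 * of_real pi * \<i>) ^ Suc k
       * dirichlet_L (\<lambda>n. cnj (chi n)) (of_nat (Suc k))
    - gauss_sum q chi * (2 * of_real pi * \<i>) ^ Suc k / (of_nat q * of_real y ^ Suc k)
       * sigma_bar_exp_series k (\<lambda>n. cnj (chi n)) (4 * pi\<^sup>2 / (real q * y))"
proof -
  interpret c: odd_primitive_character q "\<lambda>n. cnj (chi n)" by (rule odd_primitive_character_cnj)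
  define \<tau> where "\<tau> = gauss_sum q chi"
  define \<tau>' where "\<tau>' = gauss_sum q (\<lambda>n. cnj (chi n))"
  have \<tau>: "\<tau> * \<tau>' = - of_nat q" unfolding \<tau>_def \<tau>'_def by (rule gauss_sum_mult_cnj)
  have q0: "q > 0" using modulus_gt_1 by simp
  obtain S where S: "\<And>v. v > 0 \<Longrightarrow> \<exists>T. (\<lambda>m. \<Sum>j. c.block k j (real (Suc m) * v)) sums T \<and>
    (\<lambda>j. \<Sum>m. c.block k j (real (Suc m) * v)) sums (T + (if k = 0 then S / of_real v else 0))"
    using c.block_swap [OF assms] by metis
  define L where "L = dirichlet_L (\<lambda>n. cnj (chi n)) (of_nat (Suc k))"
  have main: "- ((2 * of_real pi * \<i>) ^ Suc k) / fact k * \<tau>' * sigma_exp_series k chi y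
     + (if k = 0 then S * (2 * of_real pi) / of_real y else 0) =
     - (of_nat q ^ Suc k * L) + of_real (4 * pi\<^sup>2 / y) ^ Suc k / fact k *
       sigma_bar_exp_series k (\<lambda>n. cnj (chi n)) (4 * pi\<^sup>2 / (real q * y))" if y: "y > 0" for y
  proof -
    \<comment> \<open>Chosen so that exp(-2*pi*m*v) = exp(-m*y).\<close>
    define v where "v = y / (2 * pi)"
    have v: "v > 0" using y by (simp add: v_def)
    define y' where "y' = 4 * pi\<^sup>2 / (real q * y)"
    have y': "y' > 0" using y q0 by (simp add: y'_def)
    obtain T where T: "(\<lambda>m. \<Sum>j. c.block k j (real (Suc m) * v)) sums T"
      "(\<lambda>j. \<Sum>m. c.block k j (real (Suc m) * v)) sums (T + (if k = 0 then S / of_real v else 0))"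
      using S [OF v] by auto
    have T_eq: "T = - ((2 * of_real pi * \<i>) ^ Suc k) / fact k * \<tau>' * sigma_exp_series k chi y"
    proof -
      have row: "(\<Sum>j. c.block k j (real (Suc m) * v)) = - ((2 * of_real pi * \<i>) ^ Suc k) / fact k * \<tau>' *
        (\<Sum>d. of_nat (Suc d) ^ k * chi (Suc d) * of_real (exp (- (real (Suc m) * y))) ^ Suc d)" for m
      proof -
        have *: "- 2 * pi * (real (Suc m) * v) = - (real (Suc m) * y)" by (simp add: v_def)
        have "real (Suc m) * v > 0" using v by simp
        from c.block_sums [OF assms this] show ?thesis
          unfolding * complex_cnj_cnj \<tau>'_def by (rule sums_unique [symmetric])
      qed
      have "(\<lambda>m. \<Sum>j. c.block k j (real (Suc m) * v)) sums
          (- ((2 * of_real pi * \<i>) ^ Suc k) / fact k * \<tau>' * sigma_exp_series k chi y)"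
        unfolding row by (intro sums_mult sigma_exp_series_sums(1) y norm_chi_le)
      with T(1) show ?thesis by (rule sums_unique2)
    qed
    define P where "P l = cnj (chi l) * power_polylog k (of_real (exp (- (real l * y'))))" for l
    have "(\<lambda>l. P (Suc l)) sums sigma_bar_exp_series k (\<lambda>n. cnj (chi n)) y'"
      unfolding P_def by (rule sigma_bar_exp_series_sums(1) [OF y' c.norm_chi_le])
    \<comment> \<open>Lets the series start at 0, so that it can be cut into full periods matching
      the blocks.\<close>
    moreover have "P 0 = 0" by (simp add: P_def)
    ultimately have "P sums sigma_bar_exp_series k (\<lambda>n. cnj (chi n)) y'" 
      using sums_Suc [of P] by fastforce
    from sums_group [OF this q0] 
    have P: "(\<lambda>j. \<Sum>h<q. P (j * q + h)) sums sigma_bar_exp_series k (\<lambda>n. cnj (chi n)) y'"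
      by (simp add: sum.shift_bounds_nat_ivl [of _ 0, simplified] lessThan_atLeast0 add_ac)
    define l where "l n = cnj (chi n) / of_nat n ^ Suc k" for n
    have col: "(\<Sum>m. c.block k j (real (Suc m) * v)) = - (of_nat q ^ Suc k * (\<Sum>h<q. l (j * q + h)))
        + of_real (2 * pi / v) ^ Suc k / fact k * (\<Sum>h<q. P (j * q + h))" for j
    proof -
      have "(\<Sum>m. c.block k j (real (Suc m) * v)) = (\<Sum>h=1..<q. cnj (chi h) * (- 1 / of_real (j + h / q) ^ Suc k
      + of_real (2 * pi / v) ^ Suc k / fact k * power_polylog k (of_real (exp (- 2 * pi * (j + h / q) / v)))))"
        by (rule sums_unique [symmetric, OF c.block_sums_Suc [OF assms v]])
      also have "\<dots> = (\<Sum>h=1..<q. - (of_nat q ^ Suc k * l (j * q + h)) + 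
          of_real (2 * pi / v) ^ Suc k / fact k * P (j * q + h))"
      proof (intro sum.cong refl)
        fix h assume "h \<in> {1..<q}"
        have chi_eq: "chi (j * q + h) = chi h" using chi_add_mult [of h j] by (simp add: add_ac)
        have 1: "- 2 * pi * (j + h / q) / v = - (real (j * q + h) * y')"
          using q0 y by (simp add: v_def y'_def field_simps power2_eq_square)
        have 2: "complex_of_real (j + h / q) = of_nat (j * q + h) / of_nat q"
          using q0 by (simp add: field_simps)
        show "cnj (chi h) * (- 1 / of_real (j + h / q) ^ Suc k
          + of_real (2 * pi / v) ^ Suc k / fact k * power_polylog k (of_real (exp (- 2 * pi * (j + h / q) / v)))) =
          - (of_nat q ^ Suc k * l (j * q + h)) + of_real (2 * pi / v) ^ Suc k / fact k * P (j * q + h)"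
          unfolding 1 2 l_def P_def chi_eq power_divide 
          by (simp only: distrib_left) (simp add: mult_ac del: power_Suc of_nat_add of_nat_mult)
      qed
      also have "\<dots> = (\<Sum>h<q. - (of_nat q ^ Suc k * l (j * q + h)) + 
          of_real (2 * pi / v) ^ Suc k / fact k * P (j * q + h))"
      proof (rule sum_lessThan_conv [symmetric])
        have "chi (j * q) = 0" using chi_add_mult [of 0 j] by simp
        thus "- (of_nat q ^ Suc k * l (j * q + 0)) + of_real (2 * pi / v) ^ Suc k / fact k * P (j * q + 0) = 0"
          by (simp add: l_def P_def)
      qed
      finally show ?thesis by (simp only: sum.distrib sum_negf sum_distrib_left)
    qed
    \<comment> \<open>The column identity solved for the L-series: its sums over periods converge
      because those of \<open>P\<close> and of the columns do. As \<open>l\<close> tends to 0,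
      \<open>sums_of_blocks\<close> gives convergence of the series itself.\<close>
    define X where "X = (of_real (2 * pi / v) ^ Suc k / fact k * sigma_bar_exp_series k (\<lambda>n. cnj (chi n)) y'
       - (T + (if k = 0 then S / of_real v else 0))) / of_nat q ^ Suc k"
    have "(\<lambda>j. (of_real (2 * pi / v) ^ Suc k / fact k * (\<Sum>h<q. P (j * q + h))
        - (\<Sum>m. c.block k j (real (Suc m) * v))) / of_nat q ^ Suc k) sums X"
      unfolding X_def by (intro sums_divide sums_diff sums_mult P T)
    hence "(\<lambda>j. \<Sum>h<q. l (j * q + h)) sums X"
      unfolding col using q0 by (simp del: power_Suc)
    moreover have "l \<longlonglongrightarrow> 0"
    proof (rule Lim_null_comparison)
      show "\<forall>\<^sub>F n in sequentially. norm (l n) \<le> inverse (real n)"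
        using eventually_gt_at_top [of 0]
      proof eventually_elim
        case (elim n)
        have "norm (l n) \<le> 1 / real n ^ Suc k"
          unfolding l_def norm_divide norm_power norm_of_nat by (intro divide_right_mono c.norm_chi_le) simp
        also have "\<dots> \<le> 1 / real n ^ 1"
          using elim by (intro divide_left_mono power_increasing) auto
        finally show ?case by (simp add: inverse_eq_divide)
      qed
    qed (rule lim_inverse_n)
    ultimately have "l sums X" by (rule sums_of_blocks [OF q0])
    hence "L = X" unfolding L_def l_def by (intro dirichlet_L_eqI) auto
    hence "of_nat q ^ Suc k * L = of_real (2 * pi / v) ^ Suc k / fact k * sigma_bar_exp_series k (\<lambda>n. cnj (chi n)) y'
       - (T + (if k = 0 then S / of_real v else 0))"
      using q0 by (simp add: X_def del: power_Suc)
    moreover have "c = - a + b" if "a = b - c" for a b c :: complex using that by simp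
    ultimately have "T + (if k = 0 then S / of_real v else 0) = - (of_nat q ^ Suc k * L) + 
       of_real (2 * pi / v) ^ Suc k / fact k * sigma_bar_exp_series k (\<lambda>n. cnj (chi n)) y'" by blast
    moreover have "2 * pi / v = 4 * pi\<^sup>2 / y" by (simp add: v_def power2_eq_square)
    moreover have "S / of_real v = S * (2 * of_real pi) / of_real y" by (simp add: v_def)
    ultimately show ?thesis unfolding T_eq y'_def by (simp only:)
  qed
  define w where "w = (2 * of_real pi * \<i>) ^ Suc k"
  have w: "w \<noteq> 0" by (simp add: w_def)
  show ?thesis
  proof (rule that)
    fix y :: real assume y: "y > 0"
    define F where "F = sigma_exp_series k chi y"
    define F' where "F' = sigma_bar_exp_series k (\<lambda>n. cnj (chi n)) (4 * pi\<^sup>2 / (real q * y))"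
    define M where "M = (if k = 0 then S * (2 * of_real pi) / of_real y else 0)"
    \<comment> \<open>The minus sign comes from (2*pi*i)^2 = -4*pi^2 and the odd exponent.\<close>
    have e: "of_real (4 * pi\<^sup>2 / y) ^ Suc k = - (w * w) / of_real y ^ Suc k"
    proof -
      have "w * w = ((2 * of_real pi * \<i>) * (2 * of_real pi * \<i>)) ^ Suc k"
        unfolding w_def by (simp only: power_mult_distrib)
      also have "\<dots> = (- of_real (4 * pi\<^sup>2)) ^ Suc k" by (simp add: power2_eq_square algebra_simps)
      also have "\<dots> = - (of_real (4 * pi\<^sup>2) ^ Suc k)" using assms by simp
      finally show ?thesis by (simp add: power_divide del: power_Suc)
    qed
    \<comment> \<open>This factor inverts the coefficient of \<open>F\<close> in
      \<open>main\<close>, since \<open>\<tau> * \<tau>' = - of_nat q\<close>.\<close>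
    have "F = \<tau> * fact k / (of_nat q * w) * (- w / fact k * \<tau>' * F)"
    proof -
      have "\<tau> * fact k / (of_nat q * w) * (- w / fact k * \<tau>' * F) = - (\<tau> * \<tau>') / of_nat q * F"
        using w by (simp add: field_simps)
      thus ?thesis using q0 by (simp add: \<tau>)
    qed
    also have "- w / fact k * \<tau>' * F = - (of_nat q ^ Suc k * L) + (- (w * w) / of_real y ^ Suc k) / fact k * F' - M"
      using main [OF y] unfolding w_def [symmetric] F_def [symmetric] F'_def [symmetric] M_def [symmetric] e
      by (simp add: algebra_simps)
    also have "\<tau> * fact k / (of_nat q * w) * (- (of_nat q ^ Suc k * L) + (- (w * w) / of_real y ^ Suc k) / fact k * F' - M) =
       - (\<tau> * fact k / (of_nat q * w) * M) - fact k * \<tau> * of_nat q ^ k / w * L - \<tau> * w / (of_nat q * of_real y ^ Suc k) * F'"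
      using w q0 y by (simp add: field_simps)
    also have "- (\<tau> * fact k / (of_nat q * w) * M) = 
       (if k = 0 then - (\<tau> * fact k / (of_nat q * w) * (S * (2 * of_real pi))) / of_real y else 0)"
      by (simp add: M_def)
    finally show "sigma_exp_series k chi y =
      (if k = 0 then - (\<tau> * fact k / (of_nat q * w) * (S * (2 * of_real pi))) / of_real y else 0)
      - fact k * gauss_sum q chi * of_nat q ^ k / (2 * of_real pi * \<i>) ^ Suc k
         * dirichlet_L (\<lambda>n. cnj (chi n)) (of_nat (Suc k))
      - gauss_sum q chi * (2 * of_real pi * \<i>) ^ Suc k / (of_nat q * of_real y ^ Suc k)
         * sigma_bar_exp_series k (\<lambda>n. cnj (chi n)) (4 * pi\<^sup>2 / (real q * y))"
      unfolding F_def F'_def L_def \<tau>_def w_def .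
  qed
qed

text \<open>The residue at the origin in weight one is found by applying the transformation twice:
  \<open>y \<mapsto> 4 * pi^2 / (q * y)\<close> is an involution exchanging the character with its conjugate.\<close>

theorem sigma_exp_series_transform:
  assumes "even k" "y > 0"
  shows "sigma_exp_series k chi y =
    (if k = 0 then dirichlet_L chi 1 / of_real y else 0)
    - fact k * gauss_sum q chi * of_nat q ^ k / (2 * of_real pi * \<i>) ^ Suc k
       * dirichlet_L (\<lambda>n. cnj (chi n)) (of_nat (Suc k))
    - gauss_sum q chi * (2 * of_real pi * \<i>) ^ Suc k / (of_nat q * of_real y ^ Suc k)
       * sigma_bar_exp_series k (\<lambda>n. cnj (chi n)) (4 * pi\<^sup>2 / (real q * y))"
proof (cases "k = 0")
  case False
  show ?thesis
    by (rule sigma_exp_series_transform_aux [OF assms(1)]) (simp only: False assms(2) if_False)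
next
  case True
  interpret c: odd_primitive_character q "\<lambda>n. cnj (chi n)" by (rule odd_primitive_character_cnj)
  have q0: "q > 0" using modulus_gt_1 by simp
  have bar: "sigma_bar_exp_series 0 \<psi> = sigma_exp_series 0 \<psi>" for \<psi>
    by (rule ext) (simp add: sigma_bar_exp_series_def sigma_exp_series_def sigma_bar_chi_0)
  define \<tau> where "\<tau> = gauss_sum q chi"
  define \<tau>' where "\<tau>' = gauss_sum q (\<lambda>n. cnj (chi n))"
  have \<tau>: "\<tau> * \<tau>' = - of_nat q" unfolding \<tau>_def \<tau>'_def by (rule gauss_sum_mult_cnj)
  define w where "w = 2 * of_real pi * \<i>"
  have w: "w \<noteq> 0" "w * w = - of_real (4 * pi\<^sup>2)"
    by (simp_all add: w_def power2_eq_square algebra_simps)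
  define L where "L = dirichlet_L chi 1"
  define L' where "L' = dirichlet_L (\<lambda>n. cnj (chi n)) 1"
  define F where "F = sigma_exp_series 0 chi"
  define F' where "F' = sigma_exp_series 0 (\<lambda>n. cnj (chi n))"
  obtain C where "\<And>y. y > 0 \<Longrightarrow> F y = C / of_real y - \<tau> / w * L' - \<tau> * w / (of_nat q * of_real y) * F' (4 * pi\<^sup>2 / (real q * y))"
    by (rule sigma_exp_series_transform_aux [of 0])
      (auto simp: bar F_def F'_def L'_def \<tau>_def w_def intro: that)
  hence C: "F y = C / of_real y - \<tau> / w * L' - \<tau> * w / (of_nat q * of_real y) * F' (4 * pi\<^sup>2 / (real q * y))"
    if "y > 0" for y using that by simp
  obtain C' where "\<And>y. y > 0 \<Longrightarrow> F' y = C' / of_real y - \<tau>' / w * L - \<tau>' * w / (of_nat q * of_real y) * F (4 * pi\<^sup>2 / (real q * y))"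
    by (rule c.sigma_exp_series_transform_aux [of 0])
      (auto simp: bar F_def F'_def L_def \<tau>'_def w_def intro: that)
  hence C': "F' y = C' / of_real y - \<tau>' / w * L - \<tau>' * w / (of_nat q * of_real y) * F (4 * pi\<^sup>2 / (real q * y))"
    if "y > 0" for y using that by simp
  \<comment> \<open>Inserting the formula for \<open>F'\<close> at \<open>y'\<close> into that for
    \<open>F\<close> at \<open>y\<close> reproduces \<open>F y\<close> with coefficient 1, so it
    cancels. What remains equates a multiple of 1/y with a constant.\<close>
  have eq: "(C - L) / of_real y = \<tau> / w * L' + \<tau> * w * C' / of_real (4 * pi\<^sup>2)" if y: "y > 0" for y
  proof -
    define y' where "y' = 4 * pi\<^sup>2 / (real q * y)"
    have y': "y' > 0" "4 * pi\<^sup>2 / (real q * y') = y" using y q0 by (simp_all add: y'_def)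
    define r where "r = \<tau> * w / (of_nat q * of_real y)"
    have "F y = C / of_real y - \<tau> / w * L' - r * (C' / of_real y' - \<tau>' / w * L - \<tau>' * w / (of_nat q * of_real y') * F y)"
      using C [OF y] C' [OF y'(1)] unfolding y'(2) y'_def [symmetric] r_def by simp
    also have "\<dots> = C / of_real y - \<tau> / w * L' - r * (C' / of_real y') + r * (\<tau>' / w) * L + r * (\<tau>' * w / (of_nat q * of_real y')) * F y"
      by (simp add: algebra_simps)
    also have "r * (\<tau>' / w) = (\<tau> * \<tau>') / (of_nat q * of_real y)"
      using w(1) by (simp add: r_def)
    also have "\<dots> = - 1 / of_real y" using q0 by (simp add: \<tau>)
    also have "r * (\<tau>' * w / (of_nat q * of_real y')) = (\<tau> * \<tau>') * (w * w) / (of_nat q * of_nat q * of_real (y * y'))"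
      by (simp add: r_def mult_ac)
    also have "\<dots> = 1"
    proof -
      have "y * y' = 4 * pi\<^sup>2 / real q" using y by (simp add: y'_def)
      thus ?thesis using q0 by (simp add: \<tau> w(2))
    qed
    also have "r * (C' / of_real y') = \<tau> * w * C' / of_real (4 * pi\<^sup>2)"
      using y q0 by (simp add: r_def y'_def field_simps)
    finally show ?thesis by (simp add: diff_divide_distrib algebra_simps)
  qed
  have "(C - L) / of_real 1 = (C - L) / of_real 2"
    unfolding eq [OF zero_less_one] eq [OF zero_less_numeral] ..
  hence "C = L" by simp
  thus ?thesis using C [OF assms(2)] True
    by (simp add: bar F_def F'_def L_def L'_def \<tau>_def w_def)
qed

end

section \<open>Gamma and Bessel integrals\<close>

text \<open>\<open>absolutely_integrable_on\<close> refers to the completed measure; continuity on a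
  Borel set supplies the Borel measurability.\<close>

lemma set_integrable_lborelI:
  fixes f :: "real \<Rightarrow> complex"
  assumes "f absolutely_integrable_on S" "continuous_on S f" "S \<in> sets borel"
  shows "set_integrable lborel S f"
proof -
  have "(\<lambda>x. indicator S x *\<^sub>R f x) \<in> borel_measurable borel"
    using assms by (intro borel_measurable_continuous_on_indicator)
  thus ?thesis using assms(1)
    by (simp add: set_integrable_def integrable_completion)
qed

lemma continuous_on_powr_pos:
  "continuous_on {0<..} (\<lambda>t::real. complex_of_real t powr s)"
  by (intro continuous_intros) auto

lemma set_integrable_Gamma_scaled:
  assumes "Re s > 0" "p > 0"
  shows "set_integrable lborel {0<..} (\<lambda>t. complex_of_real t powr (s - 1) * of_real (exp (- (p * t))))"
proof (rule set_integrable_lborelI)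
  have "(\<lambda>t. complex_of_real t powr (s - 1) / of_real (exp (p * t))) absolutely_integrable_on {0<..}"
    by (rule absolutely_integrable_Gamma_integral [OF assms])
  thus "(\<lambda>t. complex_of_real t powr (s - 1) * of_real (exp (- (p * t)))) absolutely_integrable_on {0<..}"
    by (simp add: exp_minus field_simps)
qed (auto intro!: continuous_intros continuous_on_powr_pos)

text \<open>A positive factor leaves the argument of t unchanged, so the principal branch causes no
  correction, even for negative t.\<close>

lemma powr_scale_pos:
  assumes "p > 0" shows "complex_of_real (p * t) powr s = of_real p powr s * of_real t powr s"
proof (cases "t = 0")
  case False
  have "Ln (complex_of_real p * complex_of_real t) = of_real (ln p) + Ln (of_real t)"
    using assms False Ln_times_of_real [of p "of_real t"] by (simp add: Ln_of_real)
  thus ?thesis using assms False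
    by (simp add: powr_def Ln_of_real exp_add ring_distribs)
qed simp

lemma set_integral_Gamma_scaled:
  assumes "Re s > 0" "p > 0"
  shows "(LINT t:{0<..}|lborel. complex_of_real t powr (s - 1) * of_real (exp (- (p * t)))) =
    Gamma s / of_real p powr s"
proof -
  define f where "f x = indicator {0<..} x *\<^sub>R (complex_of_real x powr (s - 1) * of_real (exp (- x)))" for x :: real
  have "Gamma s = integral {0<..} (\<lambda>t. complex_of_real t powr (s - 1) * of_real (exp (- t)))"
    using integral_unique [OF Gamma_integral_complex' [OF assms(1)]]
    by (simp add: exp_minus field_simps)
  also have "\<dots> = (LINT t:{0<..}|lborel. complex_of_real t powr (s - 1) * of_real (exp (- t)))"
    using set_integrable_Gamma_scaled [OF assms(1), of 1]
    by (intro set_borel_integral_eq_integral(2) [symmetric]) simp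
  also have "\<dots> = (LINT x|lborel. f x)" by (simp add: set_lebesgue_integral_def f_def)
  also have "\<dots> = \<bar>p\<bar> *\<^sub>R (LINT x|lborel. f (0 + p * x))"
    using assms by (intro lborel_integral_real_affine) simp
  also have "(LINT x|lborel. f (0 + p * x)) = (LINT x|lborel. of_real p powr (s - 1) *
      (indicator {0<..} x *\<^sub>R (complex_of_real x powr (s - 1) * of_real (exp (- (p * x))))))"
  proof (intro Bochner_Integration.integral_cong refl)
    fix x :: real
    have "indicator {0<..} (p * x) = (indicator {0<..} x :: real)"
      using assms by (simp add: indicator_def zero_less_mult_iff)
    thus "f (0 + p * x) = of_real p powr (s - 1) *
      (indicator {0<..} x *\<^sub>R (complex_of_real x powr (s - 1) * of_real (exp (- (p * x)))))"
      unfolding f_def add_0_left powr_scale_pos [OF assms(2)] by simp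
  qed
  also have "\<dots> = of_real p powr (s - 1) * (LINT t:{0<..}|lborel. complex_of_real t powr (s - 1) * of_real (exp (- (p * t))))"
    unfolding set_lebesgue_integral_def by (rule integral_mult_right_zero)
  also have "\<bar>p\<bar> *\<^sub>R (of_real p powr (s - 1) * (LINT t:{0<..}|lborel. complex_of_real t powr (s - 1) * of_real (exp (- (p * t))))) =
     of_real p powr s * (LINT t:{0<..}|lborel. complex_of_real t powr (s - 1) * of_real (exp (- (p * t))))"
    using assms by (simp add: powr_diff scaleR_conv_of_real)
  finally show ?thesis using assms by simp
qed

section \<open>The Bessel function as an integral over the positive axis\<close>

lemma set_integrable_Bessel:
  assumes "Re \<nu> > 0" "b \<ge> 0"
  shows "set_integrable lborel {0<..} (\<lambda>t. complex_of_real t powr (\<nu> - 1) * of_real (exp (- t - b / t)))"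
proof (rule set_integrable_bound)
  show "set_integrable lborel {0<..} (\<lambda>t. complex_of_real t powr (\<nu> - 1) * of_real (exp (- (1 * t))))"
    by (rule set_integrable_Gamma_scaled) (use assms in auto)
  show "set_borel_measurable lborel {0<..} (\<lambda>t. complex_of_real t powr (\<nu> - 1) * of_real (exp (- t - b / t)))"
    unfolding set_borel_measurable_def measurable_lborel2
    by (intro borel_measurable_continuous_on_indicator)
      (auto intro!: continuous_intros continuous_on_powr_pos)
  show "AE t in lborel. t \<in> {0<..} \<longrightarrow> norm (complex_of_real t powr (\<nu> - 1) * of_real (exp (- t - b / t)))
      \<le> norm (complex_of_real t powr (\<nu> - 1) * of_real (exp (- (1 * t))))"
    using assms(2) by (intro AE_I2) (auto simp: norm_mult intro!: mult_left_mono)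
qed

text \<open>The substitution is s = (z/2) * exp t, with inverse \<open>g\<close>; it turns z * cosh
  t into s + z^2/(4*s).\<close>

lemma Bessel_substitution:
  fixes z :: real and \<nu> :: complex
  assumes "z > 0" "Re \<nu> > 0"
  defines "f \<equiv> \<lambda>t. exp (\<nu> * complex_of_real t) * of_real (exp (- z * cosh t))"
  shows "set_integrable lborel UNIV f"
    and "(LINT t:UNIV|lborel. f t) = of_real (z / 2) powr (- \<nu>) *
      (LINT t:{0<..}|lborel. complex_of_real t powr (\<nu> - 1) * of_real (exp (- t - (z\<^sup>2 / 4) / t)))"
proof -
  define g where "g s = ln (2 * s / z)" for s :: real
  have fg: "(1 / s) *\<^sub>R (exp (\<mu> * complex_of_real (g s)) * of_real (exp (- z * cosh (g s)))) =
      of_real (z / 2) powr (- \<mu>) * (complex_of_real s powr (\<mu> - 1) * of_real (exp (- s - (z\<^sup>2 / 4) / s)))"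
    if "s > 0" for s \<mu>
  proof -
    have E: "exp (g s) = 2 * s / z" using that assms(1) by (simp add: g_def)
    have "- z * cosh (g s) = - s - (z\<^sup>2 / 4) / s"
      unfolding cosh_field_def exp_minus E using that assms(1) by (simp add: field_simps power2_eq_square)
    moreover have "exp (\<mu> * complex_of_real (g s)) = of_real s powr \<mu> * of_real (z / 2) powr (- \<mu>)"
    proof -
      have g: "g s = ln s - ln (z / 2)" using that assms(1) by (simp add: g_def ln_div ln_mult)
      have L: "Ln (complex_of_real (z / 2)) = of_real (ln (z / 2))" "Ln (complex_of_real s) = of_real (ln s)"
        using that assms(1) Ln_of_real by (metis half_gt_zero)+
      have "complex_of_real s \<noteq> 0" "complex_of_real (z / 2) \<noteq> 0" using that assms(1) by auto
      thus ?thesis unfolding g powr_def L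
        by (simp add: exp_add [symmetric] algebra_simps del: of_real_divide)
    qed
    moreover have "of_real s powr (\<mu> - 1) = of_real s powr \<mu> / of_real s"
      using that by (simp add: powr_diff)
    ultimately show ?thesis by (simp add: scaleR_conv_of_real field_simps)
  qed
  have int: "set_integrable lborel (einterval 0 \<infinity>) (\<lambda>s. (1 / s) *\<^sub>R
      (exp (\<mu> * complex_of_real (g s)) * of_real (exp (- z * cosh (g s)))))" if "Re \<mu> > 0" for \<mu>
  proof -
    have "set_integrable lborel {0<..} (\<lambda>s. of_real (z / 2) powr (- \<mu>) *
        (complex_of_real s powr (\<mu> - 1) * of_real (exp (- s - (z\<^sup>2 / 4) / s))))"
      using set_integrable_Bessel [OF that, of "z\<^sup>2 / 4"] by (intro set_integrable_mult_right) auto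
    also have "?this \<longleftrightarrow> set_integrable lborel {0<..} (\<lambda>s. (1 / s) *\<^sub>R
      (exp (\<mu> * complex_of_real (g s)) * of_real (exp (- z * cosh (g s)))))"
      by (intro set_integrable_cong refl) (simp only: fg greaterThan_iff)
    finally show ?thesis by (simp add: zero_ereal_def)
  qed
  have deriv: "(g has_real_derivative 1 / s) (at s)" if "s > 0" for s
    using that assms(1) unfolding g_def by (auto intro!: derivative_eq_intros simp: field_simps)
  have lim0: "((ereal \<circ> g \<circ> real_of_ereal) \<longlongrightarrow> - \<infinity>) (at_right 0)"
  proof -
    have "filterlim (\<lambda>s. ln (2 / z) + ln s) at_bot (at_right 0)"
      by (rule filterlim_tendsto_add_at_bot_iff [THEN iffD2, OF tendsto_const ln_at_0])
    also have "?this \<longleftrightarrow> filterlim g at_bot (at_right 0)"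
    proof (rule filterlim_cong [OF refl refl])
      show "\<forall>\<^sub>F s in at_right 0. ln (2 / z) + ln s = g s"
        using eventually_at_right_less [of "0 :: real"]
        by eventually_elim (use assms(1) in \<open>simp add: g_def ln_div ln_mult\<close>)
    qed
    finally show ?thesis by (simp only: zero_ereal_def ereal_tendsto_simps)
  qed
  have lim1: "((ereal \<circ> g \<circ> real_of_ereal) \<longlongrightarrow> \<infinity>) (at_left \<infinity>)"
  proof -
    have "filterlim (\<lambda>s. ln (2 / z) + ln s) at_top at_top"
      by (rule filterlim_tendsto_add_at_top [OF tendsto_const ln_at_top])
    also have "?this \<longleftrightarrow> filterlim g at_top at_top"
    proof (rule filterlim_cong [OF refl refl])
      show "\<forall>\<^sub>F s in at_top. ln (2 / z) + ln s = g s"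
        using eventually_gt_at_top [of "0 :: real"]
        by eventually_elim (use assms(1) in \<open>simp add: g_def ln_div ln_mult\<close>)
    qed
    finally show ?thesis by (simp only: ereal_tendsto_simps)
  qed
  \<comment> \<open>The substitution rule for \<open>f\<close> asks for integrability on both sides.
    On the line it is first derived for the real exponent \<open>Re \<nu>\<close> by the rule for
    nonnegative integrands, and that function then dominates \<open>f\<close>.\<close>
  have real: "set_integrable lborel (einterval (-\<infinity>) \<infinity>) (\<lambda>t. exp (Re \<nu> * t) * exp (- z * cosh t))"
  proof (rule interval_integral_substitution_nonneg(1) [where g = g and g' = "\<lambda>s. 1 / s" and a = 0 and b = \<infinity>])
    have "set_integrable lborel (einterval 0 \<infinity>) (\<lambda>s. Re ((1 / s) *\<^sub>R
      (exp (of_real (Re \<nu>) * complex_of_real (g s)) * of_real (exp (- z * cosh (g s))))))"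
      using int [of "of_real (Re \<nu>)"] assms(2) unfolding set_integrable_def
      by (auto dest: integrable_Re)
    thus "set_integrable lborel (einterval 0 \<infinity>) (\<lambda>s. exp (Re \<nu> * g s) * exp (- z * cosh (g s)) * (1 / s))"
      by (simp add: exp_of_real mult_ac flip: of_real_mult)
  qed (use deriv lim0 lim1 assms in \<open>auto intro!: continuous_intros\<close>)
  show f_int: "set_integrable lborel UNIV f"
  proof (rule set_integrable_bound)
    show "set_integrable lborel UNIV (\<lambda>t. exp (Re \<nu> * t) * exp (- z * cosh t))"
      using real by simp
    show "set_borel_measurable lborel UNIV f"
      unfolding set_borel_measurable_def measurable_lborel2 f_def
      by (intro borel_measurable_continuous_on_indicator) (auto intro!: continuous_intros)
    show "AE t in lborel. t \<in> UNIV \<longrightarrow> norm (f t) \<le> norm (exp (Re \<nu> * t) * exp (- z * cosh t))"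
      by (auto simp: f_def norm_mult)
  qed
  have "(LINT t:UNIV|lborel. f t) = (LBINT t=-\<infinity>..\<infinity>. f t)"
    by (simp add: interval_lebesgue_integral_def)
  also have "\<dots> = (LBINT s=0..\<infinity>. (1 / s) *\<^sub>R f (g s))"
  proof (rule interval_integral_substitution_integrable)
    show "set_integrable lborel (einterval 0 \<infinity>) (\<lambda>s. (1 / s) *\<^sub>R f (g s))"
      unfolding f_def by (rule int) fact
    show "set_integrable lborel (einterval (-\<infinity>) \<infinity>) f" using f_int by simp
  qed (use deriv lim0 lim1 assms(1) in \<open>auto intro!: continuous_intros simp: f_def\<close>)
  also have "\<dots> = (LINT s:{0<..}|lborel. (1 / s) *\<^sub>R f (g s))"
    by (simp add: interval_lebesgue_integral_def zero_ereal_def)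
  also have "\<dots> = (LINT s:{0<..}|lborel. of_real (z / 2) powr (- \<nu>) *
      (complex_of_real s powr (\<nu> - 1) * of_real (exp (- s - (z\<^sup>2 / 4) / s))))"
    unfolding f_def by (intro set_lebesgue_integral_cong allI impI) (simp, simp only: fg greaterThan_iff)
  finally show "(LINT t:UNIV|lborel. f t) = of_real (z / 2) powr (- \<nu>) *
      (LINT t:{0<..}|lborel. complex_of_real t powr (\<nu> - 1) * of_real (exp (- t - (z\<^sup>2 / 4) / t)))"
    by simp
qed

text \<open>Folding the integral over the line at 0 produces twice the hyperbolic cosine in the
  definition of \<open>besselK\<close>.\<close>

lemma besselK_eq_set_integral:
  assumes "z > 0" "Re \<nu> > 0"
  shows "besselK \<nu> z = of_real (z / 2) powr (- \<nu>) / 2 *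
    (LINT t:{0<..}|lborel. complex_of_real t powr (\<nu> - 1) * of_real (exp (- t - (z\<^sup>2 / 4) / t)))"
proof -
  define f where "f t = exp (\<nu> * complex_of_real t) * of_real (exp (- z * cosh t))" for t
  have f_eq: "f (- t) + f t = 2 * (of_real (exp (- z * cosh t)) * cosh (\<nu> * of_real t))" for t
    by (simp add: f_def cosh_field_def algebra_simps)
  have f: "set_integrable lborel UNIV f"
    unfolding f_def [abs_def] by (rule Bessel_substitution(1) [OF assms])
  have "set_integrable lborel UNIV (\<lambda>t. f (- t))"
    using f lborel_integrable_real_affine [of f "-1" 0] by (simp add: set_integrable_def)
  hence f1: "set_integrable lborel {0<..} f" "set_integrable lborel {0<..} (\<lambda>t. f (- t))"
    using f by (auto intro: set_integrable_subset)
  have "(LINT t:UNIV|lborel. f t) = (LBINT t=-\<infinity>..\<infinity>. f t)"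
    by (simp add: interval_lebesgue_integral_def)
  also have "\<dots> = (LBINT t=-\<infinity>..0. f t) + (LBINT t=0..\<infinity>. f t)"
    using f by (intro interval_integral_sum [symmetric]) (simp add: interval_lebesgue_integrable_def)
  also have "(LBINT t=-\<infinity>..0. f t) = (LBINT t=0..\<infinity>. f (- t))"
    by (subst interval_integral_reflect) simp
  also have "(LBINT t=0..\<infinity>. f (- t)) + (LBINT t=0..\<infinity>. f t) =
      (LINT t:{0<..}|lborel. f (- t) + f t)"
    using f1 by (simp add: interval_lebesgue_integral_def zero_ereal_def set_integral_add(2))
  also have "\<dots> = (LINT t:{0<..}|lborel. 2 * (of_real (exp (- z * cosh t)) * cosh (\<nu> * of_real t)))"
    by (simp only: f_eq)
  also have "\<dots> = 2 * (LINT t:{0<..}|lborel. of_real (exp (- z * cosh t)) * cosh (\<nu> * of_real t))"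
    by simp
  also have "(LINT t:{0<..}|lborel. of_real (exp (- z * cosh t)) * cosh (\<nu> * of_real t)) =
      integral {0<..} (\<lambda>t. of_real (exp (- z * cosh t)) * cosh (\<nu> * of_real t))"
  proof (rule set_borel_integral_eq_integral(2))
    have "set_integrable lborel {0<..} (\<lambda>t. (f (- t) + f t) / 2)"
      using f1 by (intro set_integrable_divide set_integral_add(1)) auto
    thus "set_integrable lborel {0<..} (\<lambda>t. of_real (exp (- z * cosh t)) * cosh (\<nu> * of_real t))"
      unfolding f_eq by simp
  qed
  also have "\<dots> = integral {0..} (\<lambda>t. of_real (exp (- z * cosh t)) * cosh (\<nu> * of_real t))"
    by (rule integral_spike_set) (rule negligible_subset [OF negligible_sing [of 0]], force)+
  finally have "besselK \<nu> z = (LINT t:UNIV|lborel. f t) / 2"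
    by (simp add: besselK_def)
  also have "(LINT t:UNIV|lborel. f t) = of_real (z / 2) powr (- \<nu>) *
    (LINT t:{0<..}|lborel. complex_of_real t powr (\<nu> - 1) * of_real (exp (- t - (z\<^sup>2 / 4) / t)))"
    unfolding f_def by (rule Bessel_substitution(2) [OF assms])
  finally show ?thesis by simp
qed

section \<open>Termwise integration\<close>

lemma set_integral_sums:
  fixes f :: "nat \<Rightarrow> real \<Rightarrow> complex"
  assumes int: "\<And>n. set_integrable lborel A (f n)"
    and sm: "\<And>t. t \<in> A \<Longrightarrow> summable (\<lambda>n. norm (f n t))"
    and bnd: "\<And>n. (LINT t:A|lborel. norm (f n t)) \<le> B n" and "summable B"
  shows "set_integrable lborel A (\<lambda>t. \<Sum>n. f n t)"
    and "(\<lambda>n. LINT t:A|lborel. f n t) sums (LINT t:A|lborel. \<Sum>n. f n t)"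
proof -
  define g where "g n t = indicator A t *\<^sub>R f n t" for n t
  have 1: "integrable lborel (g n)" for n
    using int [of n] unfolding g_def [abs_def] by (simp add: set_integrable_def)
  have 2: "summable (\<lambda>n. norm (g n t))" for t
    using sm [of t] by (cases "t \<in> A") (auto simp: g_def)
  have norm_g: "norm (g n t) = indicator A t *\<^sub>R norm (f n t)" for n t by (simp add: g_def)
  have 3: "summable (\<lambda>n. LINT t|lborel. norm (g n t))"
  proof (rule summable_comparison_test')
    show "norm (LINT t|lborel. norm (g n t)) \<le> B n" for n
      using bnd [of n] unfolding norm_g set_lebesgue_integral_def
      by (subst real_norm_def, subst abs_of_nonneg) (auto intro!: integral_nonneg_AE)
  qed fact
  have suminf: "(\<Sum>n. g n t) = indicator A t *\<^sub>R (\<Sum>n. f n t)" for t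
    by (cases "t \<in> A") (simp_all add: g_def)
  show "set_integrable lborel A (\<lambda>t. \<Sum>n. f n t)"
    using integrable_suminf [OF 1 _ 3] 2 unfolding suminf set_integrable_def by simp
  show "(\<lambda>n. LINT t:A|lborel. f n t) sums (LINT t:A|lborel. \<Sum>n. f n t)"
    using sums_integral [OF 1 _ 3] 2 unfolding suminf
    unfolding g_def set_lebesgue_integral_def by simp
qed

text \<open>The power bound, from at most \<open>n\<close> divisors, is enough against exponential
  decay. The divisor sum itself is kept for the dual series, whose exponent may exceed k + 1 only
  slightly.\<close>

lemma norm_divisor_sum_le:
  fixes c :: "nat \<Rightarrow> complex"
  assumes "n > 0" "\<And>d. norm (c d) \<le> 1"
  shows "norm (\<Sum>d | d dvd n. of_nat d ^ k * c d) \<le> (\<Sum>d | d dvd n. real d ^ k)"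
    and "(\<Sum>d | d dvd n. real d ^ k) \<le> real n ^ Suc k"
proof -
  have "norm (of_nat d ^ k * c d) \<le> real d ^ k" for d
    using mult_left_mono [OF assms(2) [of d], of "real d ^ k"] by (simp add: norm_mult norm_power)
  thus "norm (\<Sum>d | d dvd n. of_nat d ^ k * c d) \<le> (\<Sum>d | d dvd n. real d ^ k)"
    by (intro sum_norm_le)
  have "{d. d dvd n} \<subseteq> {1..n}"
  proof
    fix d assume "d \<in> {d. d dvd n}"
    hence "d \<le> n" "d \<noteq> 0" using assms(1) by (auto dest: dvd_imp_le)
    thus "d \<in> {1..n}" by simp
  qed
  hence card: "card {d. d dvd n} \<le> n" using card_mono [of "{1..n}" "{d. d dvd n}"] by simp
  have "(\<Sum>d | d dvd n. real d ^ k) \<le> (\<Sum>d | d dvd n. real n ^ k)"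
    using assms(1) by (intro sum_mono power_mono) (auto dest: dvd_imp_le)
  also have "\<dots> \<le> real n * real n ^ k" using card by (simp add: mult_right_mono)
  finally show "(\<Sum>d | d dvd n. real d ^ k) \<le> real n ^ Suc k" by simp
qed

lemma norm_sigma_chi_le:
  assumes "\<And>n. norm (chi n) \<le> 1" "n > 0"
  shows "norm (sigma_chi k chi n) \<le> real n ^ Suc k"
  using norm_divisor_sum_le [OF assms(2), of chi k] assms(1) by (auto simp: sigma_chi_def intro: order.trans)

lemma norm_sigma_bar_chi_le:
  assumes "\<And>n. norm (chi n) \<le> 1" "n > 0"
  shows "norm (sigma_bar_chi k chi n) \<le> (\<Sum>d | d dvd n. real d ^ k)"
    and "norm (sigma_bar_chi k chi n) \<le> real n ^ Suc k"
  using norm_divisor_sum_le [OF assms(2), of "\<lambda>d. chi (n div d)" k] assms(1)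
  by (auto simp: sigma_bar_chi_def intro: order.trans)

lemma summable_norm_exp_series:
  fixes c :: "nat \<Rightarrow> complex"
  assumes "\<And>n. norm (c (Suc n)) \<le> real (Suc n) ^ m" "y > 0"
  shows "summable (\<lambda>n. norm (c (Suc n) * of_real (exp (- (real (Suc n) * y)))))"
proof (rule summable_comparison_test')
  have "norm (exp (- y)) < 1" using assms(2) by simp
  from summable_power_polylog [OF this, of m]
  show "summable (\<lambda>n. norm (real (Suc n) ^ m * exp (- y) ^ Suc n))" .
  have e: "exp (- (real (Suc n) * y)) = exp (- y) ^ Suc n" for n
    by (simp only: exp_of_nat_mult [symmetric] mult_minus_right)
  show "norm (norm (c (Suc n) * of_real (exp (- (real (Suc n) * y))))) \<le> norm (real (Suc n) ^ m * exp (- y) ^ Suc n)" for n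
    unfolding e norm_mult by (intro mult_mono order.trans [OF _ assms(1)]) (auto simp: norm_power norm_mult intro: order.trans [OF assms(1)])
qed

lemma exp_minus_le_power:
  assumes "u > (0::real)" shows "exp (- u) \<le> fact M / u ^ M"
proof -
  have "u ^ M /\<^sub>R fact M \<le> exp u"
    using sum_le_suminf [OF summable_exp_generic [of u], of "{M}"] assms 
    by (simp add: exp_def)
  hence "u ^ M \<le> fact M * exp u" by (simp add: field_simps)
  thus ?thesis using assms by (simp add: exp_minus field_simps)
qed

lemma powr_mult_power:
  assumes "t > (0::real)"
  shows "complex_of_real t powr s * of_real t ^ M = of_real t powr (s + of_nat M)"
  using assms by (simp add: powr_add powr_nat')

lemma sigma_Bessel_sums:
  fixes b :: real and \<nu> :: complex
  assumes "b > 0" "Re \<nu> > 0" and chi: "\<And>n. norm (chi n) \<le> 1"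
  shows "(\<lambda>n. sigma_chi k chi (Suc n) *
      (LINT t:{0<..}|lborel. complex_of_real t powr (\<nu> - 1) * of_real (exp (- t - real (Suc n) * b / t)))) sums
    (LINT t:{0<..}|lborel. complex_of_real t powr (\<nu> - 1) * of_real (exp (- t)) * sigma_exp_series k chi (b / t))"
proof -
  \<comment> \<open>Bounding exp(-n*b/t) by a multiple of (t/(n*b))^M against n^(k+1) for
    \<open>sigma_chi\<close> leaves 1/n^2; the factor t^M merely raises the Gamma exponent, as in
    \<open>g\<close>.\<close>
  define M where "M = k + 3"
  define f where "f n t = sigma_chi k chi (Suc n) *
      (complex_of_real t powr (\<nu> - 1) * of_real (exp (- t - real (Suc n) * b / t)))" for n t
  define g where "g t = complex_of_real t powr (\<nu> + of_nat M - 1) * of_real (exp (- (1 * t)))" for t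
  have g: "set_integrable lborel {0<..} g"
    unfolding g_def using assms(2) by (intro set_integrable_Gamma_scaled) auto
  have int: "set_integrable lborel {0<..} (f n)" for n
    unfolding f_def using assms by (intro set_integrable_mult_right set_integrable_Bessel) auto
  have f_eq: "f n t = complex_of_real t powr (\<nu> - 1) * of_real (exp (- t)) *
      (sigma_chi k chi (Suc n) * of_real (exp (- (real (Suc n) * (b / t)))))" for n t
  proof -
    have "exp (- t - real (Suc n) * b / t) = exp (- t) * exp (- (real (Suc n) * (b / t)))"
      by (simp add: exp_add [symmetric])
    thus ?thesis unfolding f_def by (simp only: of_real_mult mult_ac)
  qed
  have "(\<lambda>n. LINT t:{0<..}|lborel. f n t) sums (LINT t:{0<..}|lborel. \<Sum>n. f n t)"
  proof (rule set_integral_sums(2) [OF int])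
    fix t :: real assume t: "t \<in> {0<..}"
    have "summable (\<lambda>n. norm (sigma_chi k chi (Suc n) * of_real (exp (- (real (Suc n) * (b / t))))))"
      using t assms(1)
      by (intro summable_norm_exp_series [of _ "Suc k"] norm_sigma_chi_le chi) auto
    thus "summable (\<lambda>n. norm (f n t))"
      unfolding f_eq norm_mult by (intro summable_mult)
  next
    fix n
    define K where "K = real (Suc n) ^ Suc k * (fact M / (real (Suc n) * b) ^ M)"
    have "(LINT t:{0<..}|lborel. norm (f n t)) \<le> (LINT t:{0<..}|lborel. K * norm (g t))"
    proof (rule set_integral_mono)
      fix t :: real assume "t \<in> {0<..}"
      hence t: "t > 0" by simp
      have "norm (f n t) = norm (complex_of_real t powr (\<nu> - 1)) * exp (- t) * 
         (norm (sigma_chi k chi (Suc n)) * exp (- (real (Suc n) * b / t)))"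
        unfolding f_eq by (simp add: norm_mult)
      also have "\<dots> \<le> norm (complex_of_real t powr (\<nu> - 1)) * exp (- t) * 
         (real (Suc n) ^ Suc k * (fact M / (real (Suc n) * b / t) ^ M))"
        using t assms(1)
        by (intro mult_left_mono mult_mono norm_sigma_chi_le chi exp_minus_le_power) auto
      also have "\<dots> = K * (norm (complex_of_real t powr (\<nu> - 1)) * t ^ M * exp (- t))"
        using t by (simp add: K_def power_divide)
      also have "norm (complex_of_real t powr (\<nu> - 1)) * t ^ M * exp (- t) = norm (g t)"
      proof -
        have "g t = complex_of_real t powr (\<nu> - 1) * of_real t ^ M * of_real (exp (- t))"
          unfolding g_def powr_mult_power [OF t] by (simp add: algebra_simps)
        thus ?thesis using t by (simp add: norm_mult norm_power)
      qed
      finally show "norm (f n t) \<le> K * norm (g t)" .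
    qed (use g int in \<open>auto intro!: set_integrable_mult_right set_integrable_norm\<close>)
    also have "\<dots> = K * (LINT t:{0<..}|lborel. norm (g t))" by simp
    also have "K = fact M / b ^ M * (1 / real (Suc n) ^ 2)"
    proof -
      have "M = Suc k + 2" by (simp add: M_def)
      hence "real (Suc n) ^ M = real (Suc n) ^ Suc k * real (Suc n) ^ 2"
        by (simp only: power_add)
      thus ?thesis unfolding K_def power_mult_distrib by (simp del: of_nat_Suc power_Suc)
    qed
    finally show "(LINT t:{0<..}|lborel. norm (f n t)) \<le>
      fact M / b ^ M * (1 / real (Suc n) ^ 2) * (LINT t:{0<..}|lborel. norm (g t))" .
  next
    have "summable (\<lambda>n. inverse (real n ^ 2))" by (rule inverse_power_summable) simp
    hence "summable (\<lambda>n. inverse (real (Suc n) ^ 2))" by (subst summable_Suc_iff)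
    hence "summable (\<lambda>n. 1 / real (Suc n) ^ 2)" by (simp only: inverse_eq_divide)
    thus "summable (\<lambda>n. fact M / b ^ M * (1 / real (Suc n) ^ 2) * (LINT t:{0<..}|lborel. norm (g t)))"
      by (intro summable_mult summable_mult2)
  qed
  also have "(LINT t:{0<..}|lborel. \<Sum>n. f n t) = (LINT t:{0<..}|lborel.
      complex_of_real t powr (\<nu> - 1) * of_real (exp (- t)) * sigma_exp_series k chi (b / t))"
  proof (intro set_lebesgue_integral_cong allI impI)
    fix t :: real assume "t \<in> {0<..}"
    hence "b / t > 0" using assms(1) by simp
    from sums_mult [OF sigma_exp_series_sums(2) [OF this chi]]
    show "(\<Sum>n. f n t) = complex_of_real t powr (\<nu> - 1) * of_real (exp (- t)) * sigma_exp_series k chi (b / t)"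
      unfolding f_eq by (rule sums_unique [symmetric])
  qed simp
  finally show ?thesis unfolding f_def by simp
qed

text \<open>The Dirichlet series of zeta(s) * zeta(s - k) at s = \<open>\<sigma>\<close>, obtained
  by grouping a product of two convergent series by the product of the indices.\<close>

lemma summable_divisor_powr:
  assumes "\<sigma> > real k + 1"
  shows "summable (\<lambda>n. (\<Sum>d | d dvd Suc n. real d ^ k) * real (Suc n) powr (- \<sigma>))"
proof -
  define f where "f i j = complex_of_real (real (Suc i) ^ k * (real (Suc i) * real (Suc j)) powr (- \<sigma>))" for i j
  have bnd: "norm (f i j) \<le> real (Suc i) powr (real k - \<sigma>) * real (Suc j) powr (- \<sigma>)" for i j
  proof -
    have "norm (f i j) = real (Suc i) ^ k * (real (Suc i) powr (- \<sigma>) * real (Suc j) powr (- \<sigma>))"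
      unfolding f_def norm_of_real powr_mult by (simp add: abs_mult)
    also have "real (Suc i) ^ k = real (Suc i) powr real k"
      by (subst powr_realpow) auto
    finally show ?thesis by (simp add: powr_add [symmetric] mult.assoc [symmetric] del: of_nat_Suc)
  qed
  have summable_powr: "summable (\<lambda>i. real (Suc i) powr e)" if "e < - 1" for e
  proof -
    have "summable (\<lambda>i. real i powr e)" using that by (simp add: summable_real_powr_iff)
    thus ?thesis by (subst summable_Suc_iff)
  qed
  have sm: "summable (\<lambda>i. real (Suc i) powr (real k - \<sigma>))" "summable (\<lambda>i. real (Suc i) powr (- \<sigma>))"
    by (rule summable_powr, use assms in simp)+
  have nn: "real (Suc i) powr (real k - \<sigma>) \<ge> 0" "real (Suc i) powr (- \<sigma>) \<ge> 0" for i by simp_all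
  show ?thesis
  proof (rule double_sums [OF sm nn bnd])
    assume *: "summable (\<lambda>n. \<Sum>d | d dvd Suc n. norm (f (d - 1) (Suc n div d - 1)))"
    have "(\<Sum>d | d dvd Suc n. norm (f (d - 1) (Suc n div d - 1))) =
        (\<Sum>d | d dvd Suc n. real d ^ k) * real (Suc n) powr (- \<sigma>)" for n
      unfolding sum_distrib_right
    proof (intro sum.cong refl)
      fix d assume "d \<in> {d. d dvd Suc n}"
      hence d: "d dvd Suc n" by simp
      show "norm (f (d - 1) (Suc n div d - 1)) = real d ^ k * real (Suc n) powr (- \<sigma>)"
        unfolding f_def dvd_Suc_props [OF d] norm_of_real by (simp add: abs_mult)
    qed
    with * show ?thesis by simp
  qed
qed

text \<open>Each term exp(-t) * exp(-n*t/c) is a Gamma integrand with scale 1 + n/c. For the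
  majorant the scale is bounded below by n/c.\<close>

lemma sigma_bar_Gamma_sums:
  fixes c :: real and s :: complex
  assumes "c > 0" "Re s > real k + 1" and chi: "\<And>n. norm (chi n) \<le> 1"
  shows "set_integrable lborel {0<..} (\<lambda>t. complex_of_real t powr (s - 1) * of_real (exp (- t)) *
      sigma_bar_exp_series k chi (t / c))"
    and "(\<lambda>n. sigma_bar_chi k chi (Suc n) * (Gamma s / of_real (1 + real (Suc n) / c) powr s)) sums
    (LINT t:{0<..}|lborel. complex_of_real t powr (s - 1) * of_real (exp (- t)) * sigma_bar_exp_series k chi (t / c))"
proof -
  define p where "p n = 1 + real (Suc n) / c" for n
  have p: "p n > 0" for n using assms(1) by (simp add: p_def add_pos_nonneg)
  define f where "f n t = sigma_bar_chi k chi (Suc n) *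
      (complex_of_real t powr (s - 1) * of_real (exp (- (p n * t))))" for n t
  have s: "Re s > 0" using assms(2) by simp
  have int: "set_integrable lborel {0<..} (f n)" for n
    unfolding f_def using p s by (intro set_integrable_mult_right set_integrable_Gamma_scaled) auto
  have f_eq: "f n t = complex_of_real t powr (s - 1) * of_real (exp (- t)) *
      (sigma_bar_chi k chi (Suc n) * of_real (exp (- (real (Suc n) * (t / c)))))" for n t
  proof -
    have "exp (- (p n * t)) = exp (- t) * exp (- (real (Suc n) * (t / c)))"
      by (simp add: exp_add [symmetric] p_def algebra_simps add_divide_distrib)
    thus ?thesis unfolding f_def by (simp only: of_real_mult mult_ac)
  qed
  \<comment> \<open>The norm lets the real integral of the absolute values be read off from the
    complex Gamma formula, since that integral is nonnegative.\<close>
  define K where "K = norm (Gamma (complex_of_real (Re s)))"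
  have sm: "summable (\<lambda>n. norm (f n t))" if "t \<in> {0<..}" for t
  proof -
    have "summable (\<lambda>n. norm (sigma_bar_chi k chi (Suc n) * of_real (exp (- (real (Suc n) * (t / c))))))"
      using that assms(1)
      by (intro summable_norm_exp_series [of _ "Suc k"] norm_sigma_bar_chi_le(2) chi) auto
    thus ?thesis unfolding f_eq norm_mult by (intro summable_mult)
  qed
  have bnd: "(LINT t:{0<..}|lborel. norm (f n t)) \<le>
      (\<Sum>d | d dvd Suc n. real d ^ k) * real (Suc n) powr (- Re s) * (K * c powr Re s)" for n
  proof -
    have "(LINT t:{0<..}|lborel. norm (f n t)) =
      (LINT t:{0<..}|lborel. norm (sigma_bar_chi k chi (Suc n)) * (t powr (Re s - 1) * exp (- (p n * t))))"
      by (intro set_lebesgue_integral_cong allI impI) (auto simp: f_def norm_mult norm_powr_real_powr)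
    also have "\<dots> = norm (sigma_bar_chi k chi (Suc n)) * (LINT t:{0<..}|lborel. t powr (Re s - 1) * exp (- (p n * t)))"
      by simp
    also have "(LINT t:{0<..}|lborel. t powr (Re s - 1) * exp (- (p n * t))) = K * p n powr (- Re s)"
    proof -
      have "complex_of_real (LINT t:{0<..}|lborel. t powr (Re s - 1) * exp (- (p n * t))) =
          (LINT t:{0<..}|lborel. complex_of_real (t powr (Re s - 1) * exp (- (p n * t))))"
        by (rule set_integral_complex_of_real [symmetric])
      also have "\<dots> = (LINT t:{0<..}|lborel. complex_of_real t powr (of_real (Re s) - 1) * of_real (exp (- (p n * t))))"
      proof (intro set_lebesgue_integral_cong allI impI)
        fix t :: real assume "t \<in> {0<..}"
        thus "complex_of_real (t powr (Re s - 1) * exp (- (p n * t))) =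
          complex_of_real t powr (of_real (Re s) - 1) * of_real (exp (- (p n * t)))"
          using powr_of_real [of t "Re s - 1"] by simp
      qed simp
      also have "\<dots> = Gamma (complex_of_real (Re s)) / of_real (p n) powr of_real (Re s)"
        using s p by (intro set_integral_Gamma_scaled) auto
      finally have "norm (complex_of_real (LINT t:{0<..}|lborel. t powr (Re s - 1) * exp (- (p n * t)))) =
          K * p n powr (- Re s)"
        using p [of n] by (simp only: norm_divide K_def) (simp add: norm_powr_real_powr powr_minus_divide)
      moreover have "(LINT t:{0<..}|lborel. t powr (Re s - 1) * exp (- (p n * t))) \<ge> 0"
        unfolding set_lebesgue_integral_def by (intro integral_nonneg_AE AE_I2) (auto simp: indicator_def)
      ultimately show ?thesis by (simp only: norm_of_real abs_of_nonneg)
    qed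
    also have "norm (sigma_bar_chi k chi (Suc n)) * (K * p n powr (- Re s)) \<le>
        (\<Sum>d | d dvd Suc n. real d ^ k) * (K * (real (Suc n) powr (- Re s) * c powr Re s))"
    proof (intro mult_mono norm_sigma_bar_chi_le(1) chi)
      have "p n powr (- Re s) \<le> (real (Suc n) / c) powr (- Re s)"
        using s assms(1) by (intro powr_mono2') (auto simp: p_def)
      also have "\<dots> = real (Suc n) powr (- Re s) * c powr Re s"
        using assms(1) by (simp add: powr_divide powr_minus field_simps)
      finally show "p n powr (- Re s) \<le> real (Suc n) powr (- Re s) * c powr Re s" .
    qed (auto simp: K_def intro!: sum_nonneg)
    finally show ?thesis by (simp only: mult_ac)
  qed
  have smB: "summable (\<lambda>n. (\<Sum>d | d dvd Suc n. real d ^ k) * real (Suc n) powr (- Re s) * (K * c powr Re s))"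
    by (intro summable_mult2 summable_divisor_powr assms)
  have suminf: "(\<Sum>n. f n t) = complex_of_real t powr (s - 1) * of_real (exp (- t)) * sigma_bar_exp_series k chi (t / c)"
    if "t \<in> {0<..}" for t
  proof -
    from that have "t / c > 0" using assms(1) by simp
    from sums_mult [OF sigma_bar_exp_series_sums(2) [OF this chi]]
    show ?thesis unfolding f_eq by (rule sums_unique [symmetric])
  qed
  have "set_integrable lborel {0<..} (\<lambda>t. \<Sum>n. f n t)"
    by (rule set_integral_sums(1) [OF int sm bnd smB])
  also have "?this \<longleftrightarrow> set_integrable lborel {0<..} (\<lambda>t. complex_of_real t powr (s - 1) * of_real (exp (- t)) *
      sigma_bar_exp_series k chi (t / c))"
    by (intro set_integrable_cong refl suminf)
  finally show "set_integrable lborel {0<..} (\<lambda>t. complex_of_real t powr (s - 1) * of_real (exp (- t)) *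
      sigma_bar_exp_series k chi (t / c))" .
  have "(\<lambda>n. LINT t:{0<..}|lborel. f n t) sums (LINT t:{0<..}|lborel. \<Sum>n. f n t)"
    by (rule set_integral_sums(2) [OF int sm bnd smB])
  also have "(LINT t:{0<..}|lborel. \<Sum>n. f n t) = (LINT t:{0<..}|lborel. 
      complex_of_real t powr (s - 1) * of_real (exp (- t)) * sigma_bar_exp_series k chi (t / c))"
    by (intro set_lebesgue_integral_cong allI impI suminf) auto
  also have "(\<lambda>n. LINT t:{0<..}|lborel. f n t) = (\<lambda>n. sigma_bar_chi k chi (Suc n) * (Gamma s / of_real (1 + real (Suc n) / c) powr s))"
    unfolding f_def using set_integral_Gamma_scaled [OF s p] by (simp add: p_def)
  finally show "(\<lambda>n. sigma_bar_chi k chi (Suc n) * (Gamma s / of_real (1 + real (Suc n) / c) powr s)) sums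
    (LINT t:{0<..}|lborel. complex_of_real t powr (s - 1) * of_real (exp (- t)) * sigma_bar_exp_series k chi (t / c))" .
qed

section \<open>The summation formula\<close>

lemma imaginary_power_odd: "even k \<Longrightarrow> \<i> ^ Suc k = (-1) ^ (k div 2) * \<i>"
  by (auto elim!: evenE simp: power_mult)

lemma powr_exp_real: "complex_of_real (exp l) powr s = exp (s * of_real l)"
  by (simp add: powr_def Ln_of_real)

context odd_primitive_character
begin

text \<open>At y = b/t the factors 1, 1/y and y^(-k-1) become multiples of 1, t and t^(k+1), whence
  Gamma at \<nu>, \<nu> + 1 and \<nu> + k + 1; the argument of the dual series becomes t/c.\<close>

lemma sigma_exp_series_Mellin:
  fixes b :: real and \<nu> :: complex
  assumes "even k" "b > 0" "Re \<nu> > 0"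
  defines "c \<equiv> real q * b / (4 * pi\<^sup>2)"
  shows "(LINT t:{0<..}|lborel. complex_of_real t powr (\<nu> - 1) * of_real (exp (- t)) * sigma_exp_series k chi (b / t)) =
    (if k = 0 then dirichlet_L chi 1 / of_real b * Gamma (1 + \<nu>) else 0)
    - fact k * gauss_sum q chi * of_nat q ^ k / (2 * of_real pi * \<i>) ^ Suc k
       * dirichlet_L (\<lambda>n. cnj (chi n)) (of_nat (Suc k)) * Gamma \<nu>
    - gauss_sum q chi * (2 * of_real pi * \<i>) ^ Suc k / (of_nat q * of_real b ^ Suc k) *
      (\<Sum>n. sigma_bar_chi k (\<lambda>n. cnj (chi n)) (Suc n) *
        (Gamma (\<nu> + of_nat k + 1) / of_real (1 + real (Suc n) / c) powr (\<nu> + of_nat k + 1)))"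
proof -
  interpret c: odd_primitive_character q "\<lambda>n. cnj (chi n)" by (rule odd_primitive_character_cnj)
  have q0: "q > 0" using modulus_gt_1 by simp
  have c: "c > 0" using q0 assms(2) by (simp add: c_def)
  define s where "s = \<nu> + of_nat k + 1"
  define F' where "F' = sigma_bar_exp_series k (\<lambda>n. cnj (chi n))"
  define C0 where "C0 = (if k = 0 then dirichlet_L chi 1 / of_real b else 0)"
  define C1 where "C1 = fact k * gauss_sum q chi * of_nat q ^ k / (2 * of_real pi * \<i>) ^ Suc k
       * dirichlet_L (\<lambda>n. cnj (chi n)) (of_nat (Suc k))"
  define C2 where "C2 = gauss_sum q chi * (2 * of_real pi * \<i>) ^ Suc k / (of_nat q * of_real b ^ Suc k)"
  have eq: "complex_of_real t powr (\<nu> - 1) * of_real (exp (- t)) * sigma_exp_series k chi (b / t) =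
     C0 * (complex_of_real t powr (\<nu> + 1 - 1) * of_real (exp (- (1 * t))))
     - C1 * (complex_of_real t powr (\<nu> - 1) * of_real (exp (- (1 * t))))
     - C2 * (complex_of_real t powr (s - 1) * of_real (exp (- t)) * F' (t / c))" if t: "t > 0" for t
  proof -
    have y: "b / t > 0" using t assms(2) by simp
    have 1: "4 * pi\<^sup>2 / (real q * (b / t)) = t / c" using t assms(2) q0 by (simp add: c_def)
    have 2: "(if k = 0 then dirichlet_L chi 1 / of_real (b / t) else 0) = C0 * of_real t"
      by (simp add: C0_def)
    have 3: "gauss_sum q chi * (2 * of_real pi * \<i>) ^ Suc k / (of_nat q * of_real (b / t) ^ Suc k) =
        C2 * of_real t ^ Suc k"
      using t assms(2) q0 by (simp add: C2_def power_divide del: power_Suc)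
    have 4: "sigma_exp_series k chi (b / t) = C0 * of_real t - C1 - C2 * of_real t ^ Suc k * F' (t / c)"
      using sigma_exp_series_transform [OF assms(1) y] unfolding 1 2 3 C1_def F'_def .
    have 5: "complex_of_real t powr (\<nu> - 1) * of_real t = of_real t powr (\<nu> + 1 - 1)"
      using powr_mult_power [OF t, of "\<nu> - 1" 1] by simp
    have 6: "complex_of_real t powr (\<nu> - 1) * of_real t ^ Suc k = of_real t powr (s - 1)"
      using powr_mult_power [OF t, of "\<nu> - 1" "Suc k"] by (simp add: s_def algebra_simps del: power_Suc)
    show ?thesis unfolding 4 5 [symmetric] 6 [symmetric] by (simp add: algebra_simps del: power_Suc)
  qed
  have s: "Re s > real k + 1" using assms(3) by (simp add: s_def)
  have int: "set_integrable lborel {0<..} (\<lambda>t. C0 * (complex_of_real t powr (\<nu> + 1 - 1) * of_real (exp (- (1 * t)))))"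
    "set_integrable lborel {0<..} (\<lambda>t. C1 * (complex_of_real t powr (\<nu> - 1) * of_real (exp (- (1 * t)))))"
    "set_integrable lborel {0<..} (\<lambda>t. C2 * (complex_of_real t powr (s - 1) * of_real (exp (- t)) * F' (t / c)))"
    unfolding F'_def using assms(3)
    by (intro set_integrable_mult_right set_integrable_Gamma_scaled sigma_bar_Gamma_sums(1) c s c.norm_chi_le; simp)+
  have "(LINT t:{0<..}|lborel. complex_of_real t powr (\<nu> - 1) * of_real (exp (- t)) * sigma_exp_series k chi (b / t)) =
    (LINT t:{0<..}|lborel. C0 * (complex_of_real t powr (\<nu> + 1 - 1) * of_real (exp (- (1 * t))))
     - C1 * (complex_of_real t powr (\<nu> - 1) * of_real (exp (- (1 * t))))
     - C2 * (complex_of_real t powr (s - 1) * of_real (exp (- t)) * F' (t / c)))"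
    by (intro set_lebesgue_integral_cong allI impI eq) auto
  also have "\<dots> = C0 * (LINT t:{0<..}|lborel. complex_of_real t powr (\<nu> + 1 - 1) * of_real (exp (- (1 * t))))
     - C1 * (LINT t:{0<..}|lborel. complex_of_real t powr (\<nu> - 1) * of_real (exp (- (1 * t))))
     - C2 * (LINT t:{0<..}|lborel. complex_of_real t powr (s - 1) * of_real (exp (- t)) * F' (t / c))"
    using int by (simp only: set_integral_diff set_integral_mult_right)
  also have "(LINT t:{0<..}|lborel. complex_of_real t powr (\<nu> + 1 - 1) * of_real (exp (- (1 * t)))) = Gamma (1 + \<nu>)"
    using set_integral_Gamma_scaled [of "\<nu> + 1" 1] assms(3) by (simp add: add.commute)
  also have "(LINT t:{0<..}|lborel. complex_of_real t powr (\<nu> - 1) * of_real (exp (- (1 * t)))) = Gamma \<nu>"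
    using set_integral_Gamma_scaled [of "\<nu>" 1] assms(3) by simp
  also have "(LINT t:{0<..}|lborel. complex_of_real t powr (s - 1) * of_real (exp (- t)) * F' (t / c)) =
    (\<Sum>n. sigma_bar_chi k (\<lambda>n. cnj (chi n)) (Suc n) *
        (Gamma s / of_real (1 + real (Suc n) / c) powr s))"
    unfolding F'_def by (rule sums_unique [OF sigma_bar_Gamma_sums(2) [OF c s c.norm_chi_le]])
  finally show ?thesis unfolding s_def C1_def C2_def by (simp add: C0_def del: power_Suc)
qed

end

theorem theorem2p1:
  fixes k q :: nat and chi :: "nat \<Rightarrow> complex" and a x :: real and \<nu> :: complex
  assumes "even k"
    and "primitive_character q chi" and "odd_character q chi"
    and "a > 0" and "x > 0"
    and "Re \<nu> > 0"
  shows "(\<lambda>m. let n = Suc m in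
            sigma_chi k chi n * of_nat n powr (\<nu> / 2) * besselK \<nu> (a * sqrt (real n * x)))
     sums
      ((if k = 0 then 1 else 0) * 2 powr (\<nu> + 1) / of_real a powr (\<nu> + 2)
          * Gamma (1 + \<nu>) * dirichlet_L chi 1 * of_real x powr (- \<nu> / 2 - 1)
       + (-1) ^ (k div 2) * \<i> * of_nat q ^ k
          / (of_real a powr \<nu> * 2 powr (of_nat k + 2 - \<nu>) * of_real pi ^ (k + 1))
          * Gamma \<nu> * gauss_sum q chi * Gamma (of_nat k + 1)
          * dirichlet_L (\<lambda>n. cnj (chi n)) (of_nat k + 1) * of_real x powr (- \<nu> / 2)
       - (-1) ^ (k div 2) * \<i> * of_real a powr \<nu> * of_nat q powr (\<nu> + of_nat k)
          * of_real x powr (\<nu> / 2)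
          / (2 powr (3 * \<nu> + of_nat k + 2) * of_real pi powr (2 * \<nu> + of_nat k + 1))
          * Gamma (\<nu> + of_nat k + 1) * gauss_sum q chi
          * (\<Sum>m. let n = Suc m in
               sigma_bar_chi k (\<lambda>j. cnj (chi j)) n
               / of_real (real n + a\<^sup>2 * real q * x / (16 * pi\<^sup>2)) powr (\<nu> + of_nat k + 1)))"
proof -
  interpret odd_primitive_character q chi by standard fact+
  have q0: "q > 0" using modulus_gt_1 by simp
  \<comment> \<open>For z = a * sqrt(n*x) the parameter z^2/4 of the Bessel integral is n*b.\<close>
  define b where "b = a\<^sup>2 * x / 4"
  have b: "b > 0" using assms by (simp add: b_def)
  define c where "c = real q * b / (4 * pi\<^sup>2)"
  have c: "c > 0" using q0 b by (simp add: c_def)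
  have c_eq: "c = a\<^sup>2 * real q * x / (16 * pi\<^sup>2)" by (simp add: c_def b_def)
  define s where "s = \<nu> + of_nat k + 1"
  define K where "K = complex_of_real (a * sqrt x / 2) powr (- \<nu>)"
  define J where "J n = (LINT t:{0<..}|lborel. complex_of_real t powr (\<nu> - 1) * of_real (exp (- t - real (Suc n) * b / t)))" for n
  define S where "S = (\<Sum>n. sigma_bar_chi k (\<lambda>j. cnj (chi j)) (Suc n) / of_real (real (Suc n) + c) powr s)"
  define \<tau> where "\<tau> = gauss_sum q chi"
  define L where "L = dirichlet_L chi 1"
  define L' where "L' = dirichlet_L (\<lambda>n. cnj (chi n)) (of_nat k + 1)"
  define \<epsilon> :: complex where "\<epsilon> = (-1) ^ (k div 2) * \<i>"
  have \<epsilon>: "\<epsilon> * \<epsilon> = -1" unfolding \<epsilon>_def by (simp add: power2_eq_square [symmetric] power_mult_distrib power_even_eq [symmetric])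
  \<comment> \<open>The power -\<nu> of sqrt n, split off from the Bessel prefactor, cancels
    n^(\<nu>/2).\<close>
  have term_eq: "of_nat (Suc n) powr (\<nu> / 2) * besselK \<nu> (a * sqrt (real (Suc n) * x)) = K / 2 * J n" for n
  proof -
    define N where "N = real (Suc n)"
    have N: "N > 0" by (simp add: N_def)
    have 1: "(a * sqrt (N * x))\<^sup>2 / 4 = N * b"
      using assms N by (simp add: b_def power_mult_distrib)
    have 2: "a * sqrt (N * x) / 2 = sqrt N * (a * sqrt x / 2)" by (simp add: real_sqrt_mult)
    have 3: "of_real N powr (\<nu> / 2) * of_real (sqrt N) powr (- \<nu>) = 1"
      using N by (simp add: powr_def Ln_of_real ln_sqrt exp_add [symmetric])
    have "besselK \<nu> (a * sqrt (N * x)) = of_real (sqrt N) powr (- \<nu>) * (K / 2 * J n)"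
      using N assms besselK_eq_set_integral [of "a * sqrt (N * x)" \<nu>]
      unfolding 1 2 K_def J_def N_def [symmetric] by (simp only: powr_scale_pos real_sqrt_gt_zero) simp
    hence "of_real N powr (\<nu> / 2) * besselK \<nu> (a * sqrt (N * x)) =
        (of_real N powr (\<nu> / 2) * of_real (sqrt N) powr (- \<nu>)) * (K / 2 * J n)" by (simp only: mult.assoc)
    thus ?thesis unfolding 3 unfolding N_def by (simp only: of_real_of_nat_eq mult_1_left)
  qed
  have "(\<lambda>n. K / 2 * (sigma_chi k chi (Suc n) * J n)) sums (K / 2 *
    (LINT t:{0<..}|lborel. complex_of_real t powr (\<nu> - 1) * of_real (exp (- t)) * sigma_exp_series k chi (b / t)))"
    unfolding J_def by (intro sums_mult sigma_Bessel_sums b assms norm_chi_le)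
  also have "(\<lambda>n. K / 2 * (sigma_chi k chi (Suc n) * J n)) = (\<lambda>m. let n = Suc m in
      sigma_chi k chi n * of_nat n powr (\<nu> / 2) * besselK \<nu> (a * sqrt (real n * x)))"
    unfolding Let_def mult.assoc term_eq by (simp only: mult_ac)
  also have "(LINT t:{0<..}|lborel. complex_of_real t powr (\<nu> - 1) * of_real (exp (- t)) * sigma_exp_series k chi (b / t)) =
    (if k = 0 then L / of_real b * Gamma (1 + \<nu>) else 0)
    - fact k * \<tau> * of_nat q ^ k / (2 * of_real pi * \<i>) ^ Suc k * L' * Gamma \<nu>
    - \<tau> * (2 * of_real pi * \<i>) ^ Suc k / (of_nat q * of_real b ^ Suc k) *
      (\<Sum>n. sigma_bar_chi k (\<lambda>n. cnj (chi n)) (Suc n) *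
        (Gamma s / of_real (1 + real (Suc n) / c) powr s))"
    using sigma_exp_series_Mellin [OF assms(1) b assms(6)]
    unfolding L_def L'_def \<tau>_def s_def c_def [symmetric] by (simp add: add.commute del: power_Suc)
  also have "(\<Sum>n. sigma_bar_chi k (\<lambda>n. cnj (chi n)) (Suc n) *
        (Gamma s / of_real (1 + real (Suc n) / c) powr s)) = Gamma s * of_real c powr s * S"
  proof -
    have e: "sigma_bar_chi k (\<lambda>n. cnj (chi n)) (Suc n) * (Gamma s / of_real (1 + real (Suc n) / c) powr s) =
       Gamma s * of_real c powr s * (sigma_bar_chi k (\<lambda>n. cnj (chi n)) (Suc n) / of_real (real (Suc n) + c) powr s)" for n
    proof -
      have "real (Suc n) + c = c * (1 + real (Suc n) / c)" using c by (simp add: field_simps)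
      hence "complex_of_real (real (Suc n) + c) powr s = of_real c powr s * of_real (1 + real (Suc n) / c) powr s"
        by (simp only: powr_scale_pos c)
      thus ?thesis using c by simp
    qed
    \<comment> \<open>Dividing by this nonzero factor transfers summability to the series in (n +
      c)^(-s).\<close>
    have cs: "Gamma s * of_real c powr s \<noteq> 0"
      using c assms(6) by (auto simp: s_def Gamma_eq_zero_iff elim!: nonpos_Ints_cases dest: arg_cong [of _ _ Re])
    have "norm (cnj (chi n)) \<le> 1" for n by (simp add: norm_chi_le)
    moreover have "Re s > real k + 1" using assms(6) by (simp add: s_def)
    ultimately have "summable (\<lambda>n. sigma_bar_chi k (\<lambda>n. cnj (chi n)) (Suc n) * 
        (Gamma s / of_real (1 + real (Suc n) / c) powr s))"
      using sums_summable [OF sigma_bar_Gamma_sums(2) [OF c, of k s "\<lambda>n. cnj (chi n)"]] by simp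
    hence "summable (\<lambda>n. sigma_bar_chi k (\<lambda>n. cnj (chi n)) (Suc n) / of_real (real (Suc n) + c) powr s)"
      unfolding e using cs by (simp only: summable_cmult_iff simp_thms)
    thus ?thesis unfolding e S_def by (rule suminf_mult)
  qed
  also have "K / 2 * ((if k = 0 then L / of_real b * Gamma (1 + \<nu>) else 0)
    - fact k * \<tau> * of_nat q ^ k / (2 * of_real pi * \<i>) ^ Suc k * L' * Gamma \<nu>
    - \<tau> * (2 * of_real pi * \<i>) ^ Suc k / (of_nat q * of_real b ^ Suc k) * (Gamma s * of_real c powr s * S)) =
      ((if k = 0 then 1 else 0) * 2 powr (\<nu> + 1) / of_real a powr (\<nu> + 2)
          * Gamma (1 + \<nu>) * L * of_real x powr (- \<nu> / 2 - 1)
       + \<epsilon> * of_nat q ^ k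
          / (of_real a powr \<nu> * 2 powr (of_nat k + 2 - \<nu>) * of_real pi ^ (k + 1))
          * Gamma \<nu> * \<tau> * Gamma (of_nat k + 1) * L' * of_real x powr (- \<nu> / 2)
       - \<epsilon> * of_real a powr \<nu> * of_nat q powr (\<nu> + of_nat k) * of_real x powr (\<nu> / 2)
          / (2 powr (3 * \<nu> + of_nat k + 2) * of_real pi powr (2 * \<nu> + of_nat k + 1))
          * Gamma s * \<tau> * S)"
  proof -
    \<comment> \<open>All bases are positive reals, so every power becomes an exponential. The three
      coefficient identities \<open>k1\<close>, \<open>k2\<close>, \<open>k3\<close> then reduce to
      polynomial identities between exponents.\<close>
    define la lx l2 lp lq where "la = complex_of_real (ln a)" and "lx = complex_of_real (ln x)"
      and "l2 = complex_of_real (ln 2)" and "lp = complex_of_real (ln pi)" and "lq = complex_of_real (ln q)"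
    have pw: "of_real a powr w = exp (w * la)" "of_real x powr w = exp (w * lx)" "2 powr w = exp (w * l2)"
      "of_real pi powr w = exp (w * lp)" "of_nat q powr w = exp (w * lq)" for w :: complex
      using assms q0 powr_exp_real [of "ln a" w] powr_exp_real [of "ln x" w] powr_exp_real [of "ln 2" w]
        powr_exp_real [of "ln pi" w] powr_exp_real [of "ln q" w]
      by (simp_all add: la_def lx_def l2_def lp_def lq_def)
    have sqrt_x: "sqrt x = exp (ln x / 2)" using assms(5) by (simp add: ln_sqrt [symmetric])
    have "a * sqrt x / 2 = exp (ln a + ln x / 2 - ln 2)"
      using assms by (simp add: exp_add exp_diff sqrt_x)
    hence K: "K = exp (- \<nu> * (la + lx / 2 - l2))"
      by (simp only: K_def powr_exp_real) (simp add: la_def lx_def l2_def)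
    have b_ln: "b = exp (2 * ln a + ln x - 2 * ln 2)"
      using assms by (simp add: b_def exp_add exp_diff exp_double)
    hence b_eq: "of_real b = exp (2 * la + lx - 2 * l2)"
      by (simp only: exp_of_real [symmetric]) (simp add: la_def lx_def l2_def)
    have "c = exp (ln q + (2 * ln a + ln x - 2 * ln 2) - 2 * ln 2 - 2 * ln pi)"
      unfolding exp_diff [of _ "2 * ln pi"] exp_diff [of "ln q + _" "2 * ln 2"]
        exp_add [of "ln q"] b_ln [symmetric] exp_double using q0 by (simp add: c_def)
    hence cs: "of_real c powr s = exp (s * (lq + (2 * la + lx - 2 * l2) - 2 * l2 - 2 * lp))"
      by (simp only: powr_exp_real) (simp add: la_def lx_def l2_def lp_def lq_def)
    have nat: "of_nat q = exp lq" "(2::complex) = exp l2" "of_real pi = exp lp"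
      using q0 by (simp_all add: lq_def l2_def lp_def exp_of_real)
    have i_pow: "(2 * of_real pi * \<i>) ^ Suc k = \<epsilon> * exp ((of_nat k + 1) * (l2 + lp))"
    proof -
      have "(2 * of_real pi * \<i>) ^ Suc k = (exp l2 * exp lp) ^ Suc k * \<i> ^ Suc k"
        by (simp only: power_mult_distrib nat(2,3) [symmetric])
      also have "(exp l2 * exp lp) ^ Suc k = exp ((of_nat k + 1) * (l2 + lp))"
        by (simp only: exp_add [symmetric] exp_of_nat_mult [symmetric] of_nat_Suc add.commute)
      finally show ?thesis by (simp only: imaginary_power_odd [OF assms(1)] \<epsilon>_def mult_ac)
    qed
    have pi_pow: "of_real pi ^ (k + 1) = exp ((of_nat k + 1) * lp)"
      by (simp only: nat exp_of_nat_mult [symmetric] of_nat_add of_nat_1)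
    have b_pow: "of_real b ^ Suc k = exp ((of_nat k + 1) * (2 * la + lx - 2 * l2))"
      by (simp only: b_eq exp_of_nat_mult [symmetric] of_nat_Suc add.commute)
    have two: "w / 2 = w * exp (- l2)" for w :: complex
      by (simp add: exp_minus l2_def exp_of_real field_simps)
    have k1: "K / 2 * (1 / of_real b) = 2 powr (\<nu> + 1) / of_real a powr (\<nu> + 2) * of_real x powr (- \<nu> / 2 - 1)"
    proof -
      have "K / 2 * (1 / of_real b) = exp (- \<nu> * (la + lx / 2 - l2) - l2 - (2 * la + lx - 2 * l2))"
        unfolding two K b_eq by (simp add: divide_inverse exp_minus [symmetric] exp_add [symmetric] algebra_simps)
      moreover have "2 powr (\<nu> + 1) / of_real a powr (\<nu> + 2) * of_real x powr (- \<nu> / 2 - 1) =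
          exp ((\<nu> + 1) * l2 - (\<nu> + 2) * la + (- \<nu> / 2 - 1) * lx)"
        unfolding pw exp_add exp_diff ..
      moreover have "- \<nu> * (la + lx / 2 - l2) - l2 - (2 * la + lx - 2 * l2) =
          (\<nu> + 1) * l2 - (\<nu> + 2) * la + (- \<nu> / 2 - 1) * lx" by (simp add: algebra_simps)
      ultimately show ?thesis by simp
    qed
    have k2: "K / 2 * (1 / exp ((of_nat k + 1) * (l2 + lp))) = 
        1 / (of_real a powr \<nu> * 2 powr (of_nat k + 2 - \<nu>) * of_real pi ^ (k + 1)) * of_real x powr (- \<nu> / 2)"
    proof -
      have "K / 2 * (1 / exp ((of_nat k + 1) * (l2 + lp))) = 
          exp (- \<nu> * (la + lx / 2 - l2) - l2 - (of_nat k + 1) * (l2 + lp))"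
        unfolding two K by (simp add: exp_diff exp_minus divide_inverse)
      moreover have "1 / (of_real a powr \<nu> * 2 powr (of_nat k + 2 - \<nu>) * of_real pi ^ (k + 1)) * of_real x powr (- \<nu> / 2) =
          exp ((- \<nu> / 2) * lx - (\<nu> * la + (of_nat k + 2 - \<nu>) * l2 + (of_nat k + 1) * lp))"
        unfolding pw pi_pow exp_add exp_diff by simp
      moreover have "- \<nu> * (la + lx / 2 - l2) - l2 - (of_nat k + 1) * (l2 + lp) =
          (- \<nu> / 2) * lx - (\<nu> * la + (of_nat k + 2 - \<nu>) * l2 + (of_nat k + 1) * lp)" by (simp add: algebra_simps)
      ultimately show ?thesis by simp
    qed
    have k3: "K / 2 * (exp ((of_nat k + 1) * (l2 + lp)) / (of_nat q * of_real b ^ Suc k)) * of_real c powr s =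
        of_real a powr \<nu> * of_nat q powr (\<nu> + of_nat k) * of_real x powr (\<nu> / 2)
          / (2 powr (3 * \<nu> + of_nat k + 2) * of_real pi powr (2 * \<nu> + of_nat k + 1))"
    proof -
      have "K / 2 * (exp ((of_nat k + 1) * (l2 + lp)) / (of_nat q * of_real b ^ Suc k)) * of_real c powr s =
          exp (- \<nu> * (la + lx / 2 - l2) - l2 + ((of_nat k + 1) * (l2 + lp) - (lq + (of_nat k + 1) * (2 * la + lx - 2 * l2)))
            + s * (lq + (2 * la + lx - 2 * l2) - 2 * l2 - 2 * lp))"
        unfolding two K b_pow cs nat(1) exp_add exp_diff by (simp add: exp_minus divide_inverse)
      moreover have "of_real a powr \<nu> * of_nat q powr (\<nu> + of_nat k) * of_real x powr (\<nu> / 2)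
          / (2 powr (3 * \<nu> + of_nat k + 2) * of_real pi powr (2 * \<nu> + of_nat k + 1)) =
          exp (\<nu> * la + (\<nu> + of_nat k) * lq + \<nu> / 2 * lx - ((3 * \<nu> + of_nat k + 2) * l2 + (2 * \<nu> + of_nat k + 1) * lp))"
        unfolding pw exp_add exp_diff ..
      moreover have "- \<nu> * (la + lx / 2 - l2) - l2 + ((of_nat k + 1) * (l2 + lp) - (lq + (of_nat k + 1) * (2 * la + lx - 2 * l2)))
            + s * (lq + (2 * la + lx - 2 * l2) - 2 * l2 - 2 * lp) =
          \<nu> * la + (\<nu> + of_nat k) * lq + \<nu> / 2 * lx - ((3 * \<nu> + of_nat k + 2) * l2 + (2 * \<nu> + of_nat k + 1) * lp)"
        by (simp add: s_def algebra_simps)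
      ultimately show ?thesis by simp
    qed
    have \<epsilon>0: "\<epsilon> \<noteq> 0" using \<epsilon> by auto
    \<comment> \<open>Since \<open>\<epsilon> * \<epsilon> = -1\<close>, moving \<epsilon> to the
      numerator changes the sign; this makes the L-value term positive in the final formula.\<close>
    have inv: "1 / (\<epsilon> * w) = - \<epsilon> * (1 / w)" for w
      using \<epsilon> \<epsilon>0 by (cases "w = 0") (simp_all add: divide_simps)
    have fact: "Gamma (of_nat k + 1) = (fact k :: complex)"
      using Gamma_fact [of k, where 'a = complex] by (simp add: add.commute)
    define P where "P = exp ((of_nat k + 1) * (l2 + lp))"
    have "K / 2 * ((if k = 0 then L / of_real b * Gamma (1 + \<nu>) else 0)
      - fact k * \<tau> * of_nat q ^ k / (\<epsilon> * P) * L' * Gamma \<nu>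
      - \<tau> * (\<epsilon> * P) / (of_nat q * of_real b ^ Suc k) * (Gamma s * of_real c powr s * S)) =
      (if k = 0 then 1 else 0) * (K / 2 * (1 / of_real b)) * Gamma (1 + \<nu>) * L
      - fact k * \<tau> * of_nat q ^ k * (1 / (\<epsilon> * P)) * (K / 2) * L' * Gamma \<nu>
      - \<tau> * \<epsilon> * (K / 2 * (P / (of_nat q * of_real b ^ Suc k)) * of_real c powr s) * Gamma s * S"
      by (simp add: algebra_simps del: power_Suc)
    also have "fact k * \<tau> * of_nat q ^ k * (1 / (\<epsilon> * P)) * (K / 2) * L' * Gamma \<nu> =
      - (fact k * \<tau> * of_nat q ^ k * \<epsilon> * (K / 2 * (1 / P)) * L' * Gamma \<nu>)"
      unfolding inv by simp
    finally show ?thesis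
      unfolding i_pow P_def k1 k2 k3 fact by (simp add: mult_ac)
  qed
  finally show ?thesis
    unfolding L_def L'_def \<tau>_def \<epsilon>_def s_def S_def c_eq Let_def .
qed

end
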